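(* Let $K,K' \subseteq \mathbb{R}^d$ be compact sets, and let $g \in PW_{K'}$, $g \neq 0$. If $U \subseteq \mathbb{R}^{2d}$ is a lattice such that $(K'-K') \times (K-K)$ is contained in a fundamental domain of the dual lattice $U^*$, then $U$ is a uniqueness set for phase retrieval in $L^2(K)$ with window $g$. For instance, this holds if $$U = \tfrac{1}{\mathrm{diam}(K')}\mathbb{Z}^d \times \tfrac{1}{\mathrm{diam}(K)}\mathbb{Z}^d.$$
   Context: A lattice in $\mathbb{R}^{2d}$ is a set $U=M\mathbb{Z}^{2d}$ with $M\in\mathrm{GL}(2d,\mathbb{R})$; its dual (reciprocal) lattice is $U^*=M^{-T}\mathbb{Z}^{2d}$. A fundamental domain of a lattice $L\subseteq\mathbb{R}^{2d}$ is a measurable set whose translates by elements of $L$ cover $\mathbb{R}^{2d}$ and pairwise overlap only in Lebesgue null sets. For sets $A,B\subseteq\mathbb{R}^d$, $A-B=\{a-b:a\in A,b\in B\}$. $\mathrm{diam}(K)=\sup\{|k-k'|:k,k'\in K\}$ with $|\cdot|$ the Euclidean norm in $\mathbb{R}^d$, and likewise for $K'$. The Fourier transform is $\mathcal{F}f(\omega)=\int_{\mathbb{R}^d}f(t)e^{-2\pi i\omega\cdot t}\,dt$, extended to a unitary operator on $L^2(\mathbb{R}^d)$. For compact $K'\subseteq\mathbb{R}^d$, the Paley–Wiener space is $PW_{K'}=\{g\in L^2(\mathbb{R}^d):\mathrm{supp}(\mathcal{F}g)\subseteq K'\}$. $L^2(K)$ is identified with the subspace $\{f\in L^2(\mathbb{R}^d):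 \mathrm{supp}(f)\subseteq K\}$ of $L^2(\mathbb{R}^d)$ (complex-valued functions, Lebesgue measure). The short-time Fourier transform of $f\in L^2(\mathbb{R}^d)$ with window $g\in L^2(\mathbb{R}^d)$ is $V_gf(x,\xi)=\int_{\mathbb{R}^d}f(t)\overline{g(t-x)}e^{-2\pi i\xi\cdot t}\,dt$ for $x,\xi\in\mathbb{R}^d$. A set $U\subseteq\mathbb{R}^{2d}$ is a uniqueness set for phase retrieval in $X\subseteq L^2(\mathbb{R}^d)$ with window $g$ if, whenever $f,h\in X$ satisfy $|V_gf(u)|=|V_gh(u)|$ for all $u\in U$, there is $\tau\in\mathbb{C}$ with $|\tau|=1$ and $f=\tau h$.
   Formalization: The example lattice is taken with spacings 1/(2 diam(K')) and 1/(2 diam(K)), and diam(K) > 0; with the printed spacings the containment fails, e.g. for d = 1, K = K' = [0,1], where [-1,1]^2 has measure 4 but a fundamental domain of Z^2 has measure 1. *)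

theory Defs
  imports "HOL-Analysis.Analysis"
begin

section \<open>Square-integrable functions and the Fourier transform\<close>

text \<open>
  Elements of L^2 are represented by functions; equality in L^2 is equality almost everywhere.
\<close>

definition square_integrable :: "('a::euclidean_space \<Rightarrow> complex) \<Rightarrow> bool" where
  "square_integrable f \<longleftrightarrow>
     f \<in> borel_measurable lebesgue \<and> integrable lebesgue (\<lambda>t. (norm (f t))\<^sup>2)"

definition ess_support :: "('a::euclidean_space \<Rightarrow> complex) \<Rightarrow> 'a set" where
  "ess_support f =
     {x. \<forall>V. open V \<and> x \<in> V \<longrightarrow> \<not> (AE t in lebesgue. t \<in> V \<longrightarrow> f t = 0)}"

definition L2_on :: "'a::euclidean_space set \<Rightarrow> ('a \<Rightarrow> complex) set" where
  "L2_on K = {f. square_integrable f \<and> ess_support f \<subseteq> K}"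

definition fourier_integral :: "('a::euclidean_space \<Rightarrow> complex) \<Rightarrow> 'a \<Rightarrow> complex" where
  "fourier_integral f \<omega> = (LINT t|lebesgue. f t * cis (- (2 * pi * (\<omega> \<bullet> t))))"

text \<open>
  The L^2 Fourier transform is the extension by continuity of the Fourier integral from the
  integrable square-integrable functions.  It is rendered as a relation between representatives:
  \<open>fourier_L2 f F\<close> says that \<open>F\<close> represents the transform of \<open>f\<close>.
\<close>

definition fourier_L2 ::
  "('a::euclidean_space \<Rightarrow> complex) \<Rightarrow> ('a \<Rightarrow> complex) \<Rightarrow> bool" where
  "fourier_L2 f F \<longleftrightarrow> square_integrable f \<and> square_integrable F \<and>
     (\<exists>\<phi> :: nat \<Rightarrow> 'a \<Rightarrow> complex.
        (\<forall>n. square_integrable (\<phi> n) \<and> integrable lebesgue (\<phi> n)) \<and>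
        (\<lambda>n. \<integral>\<^sup>+ t. ennreal ((norm (\<phi> n t - f t))\<^sup>2) \<partial>lebesgue) \<longlonglongrightarrow> 0 \<and>
        (\<lambda>n. \<integral>\<^sup>+ \<omega>. ennreal ((norm (fourier_integral (\<phi> n) \<omega> - F \<omega>))\<^sup>2) \<partial>lebesgue) \<longlonglongrightarrow> 0)"

definition paley_wiener :: "'a::euclidean_space set \<Rightarrow> ('a \<Rightarrow> complex) set" where
  "paley_wiener K' =
     {g. square_integrable g \<and> (\<exists>G. fourier_L2 g G \<and> ess_support G \<subseteq> K')}"

section \<open>Phase retrieval from the short-time Fourier transform\<close>

definition stft ::
  "('a::euclidean_space \<Rightarrow> complex) \<Rightarrow> ('a \<Rightarrow> complex) \<Rightarrow> 'a \<Rightarrow> 'a \<Rightarrow> complex" where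
  "stft g f x \<xi> = (LINT t|lebesgue. f t * cnj (g (t - x)) * cis (- (2 * pi * (\<xi> \<bullet> t))))"

definition phase_uniqueness_set ::
  "('a::euclidean_space \<times> 'a) set \<Rightarrow> ('a \<Rightarrow> complex) set \<Rightarrow> ('a \<Rightarrow> complex) \<Rightarrow> bool" where
  "phase_uniqueness_set U X g \<longleftrightarrow>
     (\<forall>f\<in>X. \<forall>h\<in>X.
        (\<forall>(x, \<xi>)\<in>U. norm (stft g f x \<xi>) = norm (stft g h x \<xi>)) \<longrightarrow>
        (\<exists>\<tau>::complex. norm \<tau> = 1 \<and> (AE t in lebesgue. f t = \<tau> * h t)))"

section \<open>Lattices in phase space\<close>

definition int_points :: "(real ^ 'm) set" where
  "int_points = {z. \<forall>i. z $ i \<in> \<int>}"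

text \<open>
  Phase space of dimension 2d is the product of two copies of d-dimensional space; 2d x 2d
  matrices are indexed by the sum type \<open>'d + 'd\<close>, the left summand numbering the time
  coordinates and the right summand the frequency coordinates.
\<close>

definition split_vec :: "real ^ ('d::finite + 'd) \<Rightarrow> (real ^ 'd) \<times> (real ^ 'd)" where
  "split_vec v = ((\<chi> i. v $ Inl i), (\<chi> i. v $ Inr i))"

definition matrix_lattice ::
  "real ^ ('d::finite + 'd) ^ ('d + 'd) \<Rightarrow> ((real ^ 'd) \<times> (real ^ 'd)) set" where
  "matrix_lattice M = (\<lambda>z. split_vec (M *v z)) ` int_points"

definition lattice_with_dual ::
  "((real ^ 'd::finite) \<times> (real ^ 'd)) set \<Rightarrow> ((real ^ 'd) \<times> (real ^ 'd)) set \<Rightarrow> bool" where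
  "lattice_with_dual U L \<longleftrightarrow>
     (\<exists>M. invertible M \<and> U = matrix_lattice M \<and> L = matrix_lattice (transpose (matrix_inv M)))"

definition fundamental_domain :: "'b::euclidean_space set \<Rightarrow> 'b set \<Rightarrow> bool" where
  "fundamental_domain L D \<longleftrightarrow>
     D \<in> sets lebesgue \<and>
     (\<Union>l\<in>L. (+) l ` D) = UNIV \<and>
     (\<forall>l\<in>L. \<forall>l'\<in>L. l \<noteq> l' \<longrightarrow> ((+) l ` D) \<inter> ((+) l' ` D) \<in> null_sets lebesgue)"

definition difference_set :: "'a::ab_group_add set \<Rightarrow> 'a set \<Rightarrow> 'a set" where
  "difference_set A B = {a - b |a b. a \<in> A \<and> b \<in> B}"

definition sampling_lattice ::
  "(real ^ 'd::finite) set \<Rightarrow> (real ^ 'd) set \<Rightarrow> ((real ^ 'd) \<times> (real ^ 'd)) set \<Rightarrow> bool" where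
  "sampling_lattice K K' U \<longleftrightarrow>
     (\<exists>L D. lattice_with_dual U L \<and> fundamental_domain L D \<and>
        difference_set K' K' \<times> difference_set K K \<subseteq> D)"

text \<open>
  \<open>separable_lattice a b\<close> is a Z^d x b Z^d, with dual (1/a) Z^d x (1/b) Z^d for nonzero a, b.
  The set K - K lies in the cube [-diam K, diam K]^d of side 2 diam K, so the spacing for which
  this cube is a fundamental domain of the dual lattice is 1 / (2 diam K), not 1 / diam K.
\<close>

definition separable_lattice :: "real \<Rightarrow> real \<Rightarrow> ((real ^ 'd::finite) \<times> (real ^ 'd)) set" where
  "separable_lattice a b = ((\<lambda>m. a *\<^sub>R m) ` int_points) \<times> ((\<lambda>n. b *\<^sub>R n) ` int_points)"

end

theory Submission
  imports Defs "HOL-Probability.Characteristic_Functions" "HOL-Complex_Analysis.Conformal_Mappings"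
begin

text \<open>
  Let \<open>G\<close> be the Fourier transform of the window \<open>g\<close>.  It vanishes outside \<open>K'\<close>, so \<open>g\<close> is the inverse
  Fourier integral of \<open>G\<close> (\<open>fourier_inversion_compact\<close>).  For a signal \<open>f\<close> that vanishes outside \<open>K\<close>,
  inserting this integral into \<open>V_g f\<close> exhibits \<open>V_g f\<close> as a Fourier integral over phase space, namely that
  of the integrable function \<open>F(b, t) = f(-t) cnj(G b) exp(2 pi i b.t)\<close>, which lives on \<open>K' \<times> (-K)\<close>
  (\<open>stft_eq_fourier_phase_space_signal\<close>).

  Sampling.  \<open>|V_g f|^2\<close> is the Fourier integral of the autocorrelation of \<open>F\<close>, which lives on
  \<open>(K' - K') \<times> (K - K)\<close>.  The values of a Fourier integral on the lattice \<open>U\<close> depend only on the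
  periodization of the integrand along the dual lattice \<open>L\<close>.  An integrand that lives in a fundamental domain
  of \<open>L\<close> can be recovered from its periodization, because distinct translates meet only in null sets.  So the
  values of \<open>|V_g f|\<close> on \<open>U\<close> determine the autocorrelation of \<open>F\<close>
  (\<open>autocorrelation_determined_by_lattice\<close>).  The precise form of this is that an integrable function which is
  orthogonal to all characters of a lattice integrates to zero over every Borel set with the dual periods
  (\<open>integer_characters_determine\<close>), by the Stone-Weierstrass theorem on the torus and Dynkin's theorem.

  Cancelling the window.  The autocorrelation of \<open>F\<close> at \<open>(\<beta>, y)\<close> is a factor of modulus one times
  \<open>P_f(\<beta>, y) Q(\<beta>, y)\<close>, where \<open>P_f(\<cdot>, y)\<close> is the Fourier integral of \<open>t \<mapsto> a(t + y) cnj(a t)\<close> with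
  \<open>a(t) = f(-t)\<close>, and \<open>Q(\<beta>, \<cdot>)\<close> is the Fourier integral of \<open>b \<mapsto> cnj(G(b + \<beta>)) G b\<close>.
  The Fourier integral of a compactly supported function extends to an entire function along each line.  Hence,
  unless the function is zero, the integral is nonzero almost everywhere (\<open>AE_fourier_integral_neq_0\<close>).  As
  \<open>G\<close> is not zero, \<open>Q(\<beta>, \<cdot>)\<close> is not identically zero for a set of \<open>\<beta>\<close> of positive
  measure, and \<open>P_f\<close> and \<open>P_h\<close> agree for these \<open>\<beta>\<close> and almost all \<open>y\<close>.  The same lemma, now applied to
  \<open>P_f(\<cdot>, y) - P_h(\<cdot>, y)\<close>, extends this to all \<open>\<beta>\<close>.  So the products \<open>f(s) cnj(f t)\<close> and \<open>h(s) cnj(h t)\<close>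
  agree almost everywhere, and fixing a \<open>t\<close> with \<open>f t \<noteq> 0\<close> yields \<open>f = \<tau> h\<close> (\<open>eq_up_to_phase\<close>).

  For the rectangular lattice, the closed box with half-sides \<open>diam K'\<close> and \<open>diam K\<close> is a fundamental domain of the
  dual lattice.  Here \<open>diam K' > 0\<close>, because a nonzero \<open>G\<close> cannot live on a single point.
\<close>

section \<open>Functions orthogonal to polynomials or characters\<close>

text \<open>
  The closure conditions on \<open>C\<close> say that \<open>C\<close> is a vector space on which multiplication by each coordinate of
  \<open>\<theta>\<close> acts.  Formulating them for a set of functions lets polynomials be handled by plain
  induction, the product case being two successive applications of the induction hypotheses.
\<close>

lemma polynomial_times_mem:
  fixes \<theta> :: "'x \<Rightarrow> 'b::euclidean_space" and H :: "'x \<Rightarrow> complex"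
  assumes P: "real_polynomial_function P" and H: "H \<in> C"
    and add: "\<And>h k. h \<in> C \<Longrightarrow> k \<in> C \<Longrightarrow> (\<lambda>x. h x + k x) \<in> C"
    and scale: "\<And>h c. h \<in> C \<Longrightarrow> (\<lambda>x. c * h x) \<in> C"
    and coord: "\<And>h b. h \<in> C \<Longrightarrow> b \<in> Basis \<Longrightarrow> (\<lambda>x. of_real (\<theta> x \<bullet> b) * h x) \<in> C"
  shows "(\<lambda>x. of_real (P (\<theta> x)) * H x) \<in> C"
  using P H
proof (induction arbitrary: H)
  case (linear f)
  interpret bounded_linear f by fact
  have sums: "(\<lambda>x. \<Sum>b\<in>A. of_real (f b) * (of_real (\<theta> x \<bullet> b) * H x)) \<in> C" if "finite A" "A \<subseteq> Basis" for A
    using that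
  proof (induction A)
    case empty
    show ?case using assms(4)[OF linear.prems, of 0] by simp
  next
    case (insert b A)
    then have "(\<lambda>x. of_real (f b) * (of_real (\<theta> x \<bullet> b) * H x) + (\<Sum>b\<in>A. of_real (f b) * (of_real (\<theta> x \<bullet> b) * H x))) \<in> C"
      by (intro assms(3)[OF assms(4)[OF assms(5)[OF linear.prems, of b], of "of_real (f b)"]]) simp_all
    with insert show ?case by simp
  qed
  have "of_real (f (\<theta> x)) * H x = (\<Sum>b\<in>Basis. of_real (f b) * (of_real (\<theta> x \<bullet> b) * H x))" for x
  proof -
    have "f (\<theta> x) = f (\<Sum>b\<in>Basis. (\<theta> x \<bullet> b) *\<^sub>R b)" by (simp add: euclidean_representation)
    also have "\<dots> = (\<Sum>b\<in>Basis. (\<theta> x \<bullet> b) * f b)" by (simp add: sum scaleR)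
    finally show ?thesis by (simp add: sum_distrib_left sum_distrib_right mult_ac)
  qed
  with sums[of Basis] show ?case by simp
next
  case (const c)
  then show ?case by (rule assms(4))
next
  case (add f g)
  have "(\<lambda>x. of_real (f (\<theta> x)) * H x + of_real (g (\<theta> x)) * H x) \<in> C"
    by (rule assms(3)[OF add.IH(1)[OF add.prems] add.IH(2)[OF add.prems]])
  then show ?case by (simp add: distrib_right)
next
  case (mult f g)
  from mult.IH(1)[OF mult.IH(2)[OF mult.prems]] show ?case by (simp add: mult.assoc)
qed

text \<open>
  All polynomial moments of the complex measure \<open>H dM\<close>, pushed forward by the bounded map \<open>\<theta>\<close>, vanish.
  By Stone-Weierstrass on a ball, so do the integrals of continuous functions.  Closed sets follow by
  dominated convergence, and Borel sets by Dynkin's theorem.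
\<close>

lemma integral_indicator_eq_0_if_moments_eq_0:
  fixes \<theta> :: "'x \<Rightarrow> 'b::euclidean_space" and H :: "'x \<Rightarrow> complex"
  assumes H: "H \<in> C"
    and C0: "\<And>h. h \<in> C \<Longrightarrow> integrable M h \<and> integral\<^sup>L M h = 0"
    and add: "\<And>h k. h \<in> C \<Longrightarrow> k \<in> C \<Longrightarrow> (\<lambda>x. h x + k x) \<in> C"
    and scale: "\<And>h c. h \<in> C \<Longrightarrow> (\<lambda>x. c * h x) \<in> C"
    and coord: "\<And>h b. h \<in> C \<Longrightarrow> b \<in> Basis \<Longrightarrow> (\<lambda>x. of_real (\<theta> x \<bullet> b) * h x) \<in> C"
    and \<theta>[measurable]: "\<theta> \<in> borel_measurable M" and r: "\<And>x. norm (\<theta> x) \<le> r"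
    and B: "B \<in> sets borel"
  shows "(LINT x|M. of_real (indicator B (\<theta> x)) * H x) = 0"
proof -
  note [measurable] = B
  have intH[simp]: "integrable M H" and H0: "integral\<^sup>L M H = 0" using C0[OF H] by auto
  note [measurable] = borel_measurable_integrable[OF intH]
  have bdd: "integrable M (\<lambda>x. of_real (u x) * H x)" if "\<And>x. \<bar>u x\<bar> \<le> 1" and [measurable]: "u \<in> borel_measurable M" for u :: "'x \<Rightarrow> real"
    by (rule Bochner_Integration.integrable_bound[OF intH])
       (auto simp: norm_mult intro!: AE_I2 mult_left_le_one_le that)
  have cont: "(LINT x|M. of_real (q (\<theta> x)) * H x) = 0"
    if q: "continuous_on UNIV q" and q1: "\<And>v. \<bar>q v\<bar> \<le> 1" for q :: "'b \<Rightarrow> real"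
  proof -
    have [measurable]: "q \<in> borel_measurable borel"
      by (simp add: borel_measurable_continuous_onI q)
    have "norm (LINT x|M. of_real (q (\<theta> x)) * H x) \<le> e * (LINT x|M. norm (H x))" if "e > 0" for e
    proof -
      obtain P where P: "real_polynomial_function P" "\<And>v. v \<in> cball 0 r \<Longrightarrow> \<bar>q v - P v\<bar> < e"
        using Stone_Weierstrass_real_polynomial_function[of "cball 0 r" q e] \<open>e > 0\<close>
          continuous_on_subset[OF q] by auto
      have CP: "(\<lambda>x. of_real (P (\<theta> x)) * H x) \<in> C"
        by (rule polynomial_times_mem[OF P(1) H]) (use add scale coord in auto)
      have iq: "integrable M (\<lambda>x. of_real (q (\<theta> x)) * H x)"
        by (rule bdd) (use q1 in auto)
      have "(LINT x|M. of_real (q (\<theta> x)) * H x) = (LINT x|M. of_real (q (\<theta> x)) * H x - of_real (P (\<theta> x)) * H x)"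
        using C0[OF CP] iq by simp
      also have "norm \<dots> \<le> (LINT x|M. norm (of_real (q (\<theta> x)) * H x - of_real (P (\<theta> x)) * H x))"
        by (rule integral_norm_bound)
      also have "\<dots> \<le> (LINT x|M. e * norm (H x))"
      proof (rule integral_mono)
        show "integrable M (\<lambda>x. norm (of_real (q (\<theta> x)) * H x - of_real (P (\<theta> x)) * H x))"
          using C0[OF CP] iq by (intro integrable_norm Bochner_Integration.integrable_diff) auto
        show "integrable M (\<lambda>x. e * norm (H x))" by simp
        fix x
        have "norm (of_real (q (\<theta> x)) * H x - of_real (P (\<theta> x)) * H x) = \<bar>q (\<theta> x) - P (\<theta> x)\<bar> * norm (H x)"
          by (simp flip: left_diff_distrib of_real_diff add: norm_mult del: of_real_diff)
        also have "\<dots> \<le> e * norm (H x)"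
          using P(2)[of "\<theta> x"] r[of x] by (intro mult_right_mono) auto
        finally show "norm (of_real (q (\<theta> x)) * H x - of_real (P (\<theta> x)) * H x) \<le> e * norm (H x)" .
      qed
      finally show ?thesis by simp
    qed
    note * = this
    have "((\<lambda>e. e * (LINT x|M. norm (H x))) \<longlongrightarrow> 0 * (LINT x|M. norm (H x))) (at_right 0)"
      by (intro tendsto_intros)
    then have "norm (LINT x|M. of_real (q (\<theta> x)) * H x) \<le> 0 * (LINT x|M. norm (H x))"
      by (rule tendsto_lowerbound) (auto simp: eventually_at_right_less * intro!: eventually_at_rightI[of 0 1])
    then show ?thesis by simp
  qed
  have clsd: "(LINT x|M. of_real (indicator F (\<theta> x)) * H x) = 0" if F: "closed F" for F
  proof (cases "F = {}")
    case True then show ?thesis by simp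
  next
    case False
    note [measurable] = borel_closed[OF F]
    define q where "q n v = max 0 (1 - real n * infdist v F)" for n v
    have q1: "\<bar>q n v\<bar> \<le> 1" for n v unfolding q_def by (auto simp: infdist_nonneg)
    have qc: "continuous_on UNIV (q n)" for n unfolding q_def by (intro continuous_intros)
    have [measurable]: "q n \<in> borel_measurable borel" for n
      by (simp add: borel_measurable_continuous_onI qc)
    have lim: "(\<lambda>n. q n v) \<longlonglongrightarrow> indicator F v" for v
    proof (cases "v \<in> F")
      case True then show ?thesis by (simp add: q_def)
    next
      case nv: False
      with F False have pos: "infdist v F > 0"
        by (metis in_closed_iff_infdist_zero infdist_nonneg less_eq_real_def)
      obtain n0 :: nat where n0: "real n0 > 1 / infdist v F" using reals_Archimedean2 by blast
      have "\<forall>\<^sub>F n in sequentially. q n v = 0"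
        using eventually_ge_at_top[of n0]
      proof eventually_elim
        case (elim n)
        then have "real n \<ge> 1 / infdist v F" using n0 by linarith
        then show ?case using pos by (simp add: q_def field_simps)
      qed
      then show ?thesis using nv by (simp add: tendsto_eventually)
    qed
    have "(\<lambda>n. LINT x|M. of_real (q n (\<theta> x)) * H x) \<longlonglongrightarrow> (LINT x|M. of_real (indicator F (\<theta> x)) * H x)"
    proof (rule integral_dominated_convergence[where w="\<lambda>x. norm (H x)"])
      show "AE x in M. (\<lambda>n. complex_of_real (q n (\<theta> x)) * H x) \<longlonglongrightarrow> complex_of_real (indicator F (\<theta> x)) * H x"
        by (intro AE_I2 tendsto_intros tendsto_of_real lim)
    qed (use q1 in \<open>auto simp: norm_mult intro!: AE_I2 mult_left_le_one_le\<close>)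
    moreover have "(LINT x|M. of_real (q n (\<theta> x)) * H x) = 0" for n by (rule cont[OF qc q1])
    ultimately show ?thesis by (simp add: LIMSEQ_const_iff)
  qed
  have "Int_stable (Collect closed :: 'b set set)" by (auto intro!: Int_stableI)
  moreover have "(Collect closed :: 'b set set) \<subseteq> Pow UNIV" by simp
  moreover have "B \<in> sigma_sets UNIV (Collect closed)" using B by (simp add: borel_eq_closed)
  ultimately show ?thesis
  proof (induction rule: sigma_sets_induct_disjoint)
    case (basic A)
    then show ?case using clsd by simp
  next
    case (compl A)
    then have [measurable]: "A \<in> sets borel" by (simp add: borel_eq_closed)
    have "(LINT x|M. of_real (indicator (UNIV - A) (\<theta> x)) * H x) = (LINT x|M. H x - of_real (indicator A (\<theta> x)) * H x)"
      by (intro Bochner_Integration.integral_cong) (auto simp: indicator_def)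
    also have "\<dots> = 0" using compl H0 by (subst Bochner_Integration.integral_diff) (auto intro!: bdd)
    finally show ?case .
  next
    case (union A)
    then have [measurable]: "A i \<in> sets borel" for i by (auto simp: borel_eq_closed)
    have "(\<lambda>n. LINT x|M. of_real (indicator (\<Union>i<n. A i) (\<theta> x)) * H x) \<longlonglongrightarrow> (LINT x|M. of_real (indicator (\<Union>i. A i) (\<theta> x)) * H x)"
    proof (rule integral_dominated_convergence[where w="\<lambda>x. norm (H x)"])
      have "(\<lambda>n. indicator (\<Union>i<n. A i) v :: real) \<longlonglongrightarrow> indicator (\<Union>i. A i) v" for v
        by (rule LIMSEQ_indicator_UN)
      then show "AE x in M. (\<lambda>n. complex_of_real (indicator (\<Union>i<n. A i) (\<theta> x)) * H x) \<longlonglongrightarrow> complex_of_real (indicator (\<Union>i. A i) (\<theta> x)) * H x"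
        by (intro AE_I2 tendsto_intros tendsto_of_real)
    next
      have [measurable]: "(\<Union>i. A i) \<in> sets borel" "(\<Union>i<n. A i) \<in> sets borel" for n :: nat by auto
      show "(\<lambda>x. complex_of_real (indicator (\<Union>i. A i) (\<theta> x)) * H x) \<in> borel_measurable M"
        "\<And>n. (\<lambda>x. complex_of_real (indicator (\<Union>i<n. A i) (\<theta> x)) * H x) \<in> borel_measurable M" by measurable
    qed (auto simp: norm_mult intro!: AE_I2 mult_left_le_one_le)
    moreover have "(LINT x|M. of_real (indicator (\<Union>i<n. A i) (\<theta> x)) * H x) = 0" for n
    proof -
      have "of_real (indicator (\<Union>i<n. A i) v) = (\<Sum>i<n. of_real (indicator (A i) v) :: complex)" for v
        using union(1) indicator_UN_disjoint[of "{..<n}" A v, where ?'c = complex]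
        by (simp add: disjoint_family_on_def of_real_indicator)
      then have "(LINT x|M. of_real (indicator (\<Union>i<n. A i) (\<theta> x)) * H x) = (LINT x|M. (\<Sum>i<n. of_real (indicator (A i) (\<theta> x)) * H x))"
        by (simp add: sum_distrib_right)
      also have "\<dots> = 0" by (subst Bochner_Integration.integral_sum) (auto intro!: bdd simp: union)
      finally show ?thesis .
    qed
    ultimately show ?case by (simp add: LIMSEQ_const_iff)
  qed auto
qed

lemma borel_measurable_Arg [measurable]: "Arg \<in> borel_measurable borel"
proof -
  have "(\<lambda>z. if z \<in> \<real>\<^sub>\<le>\<^sub>0 then (if z = 0 then 0 else pi) else Arg z) \<in> borel_measurable borel"
  proof (rule measurable_If_restrict_space_iff[THEN iffD2])
    show "{z \<in> space borel. z \<in> (\<real>\<^sub>\<le>\<^sub>0 :: complex set)} \<in> sets borel"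
      using borel_closed[OF closed_nonpos_Reals_complex] by simp
    have "continuous_on {z. z \<notin> \<real>\<^sub>\<le>\<^sub>0} Arg"
      using continuous_on_Arg by (simp add: Compl_eq)
    then have "Arg \<in> borel_measurable (restrict_space borel {z. z \<notin> \<real>\<^sub>\<le>\<^sub>0})"
      by (rule borel_measurable_continuous_on_restrict)
    moreover have "(\<lambda>z. if z = 0 then 0 else pi) \<in> borel_measurable (restrict_space borel {z. z \<in> (\<real>\<^sub>\<le>\<^sub>0 :: complex set)})"
      by (rule measurable_restrict_space1) simp
    ultimately show "(\<lambda>z. if z = 0 then 0 else pi) \<in> borel_measurable (restrict_space borel {z. z \<in> (\<real>\<^sub>\<le>\<^sub>0 :: complex set)}) \<and>
       Arg \<in> borel_measurable (restrict_space borel {z. z \<notin> \<real>\<^sub>\<le>\<^sub>0})"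
      by simp
  qed
  moreover have "(\<lambda>z. if z \<in> \<real>\<^sub>\<le>\<^sub>0 then (if z = 0 then 0 else pi) else Arg z) = Arg"
  proof
    fix z show "(if z \<in> \<real>\<^sub>\<le>\<^sub>0 then (if z = 0 then 0 else pi) else Arg z) = Arg z"
      by (auto simp: Arg_eq_pi Arg_zero elim!: nonpos_Reals_cases)
  qed
  ultimately show ?thesis by simp
qed

lemma int_points_axis: "axis i 1 \<in> int_points" 
  by (auto simp: int_points_def axis_def)

lemma int_points_add: "k \<in> int_points \<Longrightarrow> l \<in> int_points \<Longrightarrow> k + l \<in> int_points"
  and int_points_diff: "k \<in> int_points \<Longrightarrow> l \<in> int_points \<Longrightarrow> k - l \<in> int_points"
  and int_points_0: "0 \<in> int_points"
  by (auto simp: int_points_def)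

lemma countable_int_points: "countable (int_points :: (real ^ 'm::finite) set)"
proof -
  have "int_points \<subseteq> (\<lambda>f. \<chi> i. real_of_int (f i)) ` (UNIV :: ('m \<Rightarrow> int) set)"
  proof
    fix z :: "real ^ 'm" assume "z \<in> int_points"
    then have "z = (\<chi> i. real_of_int \<lfloor>z $ i\<rfloor>)" by (auto simp: int_points_def vec_eq_iff)
    then show "z \<in> (\<lambda>f. \<chi> i. real_of_int (f i)) ` (UNIV :: ('m \<Rightarrow> int) set)"
      by (rule image_eqI[where x = "\<lambda>i. \<lfloor>z $ i\<rfloor>"]) simp
  qed
  moreover have "countable (UNIV :: ('m \<Rightarrow> int) set)" by simp
  ultimately show ?thesis by (meson countable_image countable_subset)
qed

lemma borel_measurable_cis [measurable]: "cis \<in> borel_measurable borel"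
  by (intro borel_measurable_continuous_onI continuous_intros)

lemma borel_measurable_cnj [measurable]: "cnj \<in> borel_measurable borel"
  by (intro borel_measurable_continuous_onI continuous_intros)

text \<open>
  The characters see \<open>w\<close> only through the point \<open>\<theta>\<close> of the torus with coordinates \<open>cis (2 * pi * w $ i)\<close>.
  Multiplying by a real or imaginary part of such a coordinate turns a character into a combination of
  two neighbouring characters, so the moment lemma applies to \<open>\<theta>\<close>.  A periodic Borel set is the preimage
  under \<open>\<theta>\<close> of a Borel subset of the torus, because the torus has the Borel section given by the arguments.
\<close>

lemma integer_characters_determine:
  fixes w :: "'x \<Rightarrow> real ^ 'n::finite" and H :: "'x \<Rightarrow> complex"
  assumes H: "integrable M H" and w[measurable]: "w \<in> borel_measurable M"
    and zero: "\<And>k. k \<in> int_points \<Longrightarrow> (LINT x|M. H x * cis (2 * pi * (k \<bullet> w x))) = 0"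
    and B[measurable]: "B \<in> sets borel"
    and periodic: "\<And>v k. k \<in> int_points \<Longrightarrow> v + k \<in> B \<longleftrightarrow> v \<in> B"
  shows "(LINT x|M. of_real (indicator B (w x)) * H x) = 0"
proof -
  define \<theta> where "\<theta> x = (\<chi> i. cis (2 * pi * w x $ i))" for x
  define C where "C = {h. integrable M h \<and> (\<forall>k\<in>int_points. (LINT x|M. h x * cis (2 * pi * (k \<bullet> w x))) = 0)}"
  \<comment> \<open>a Borel section of the covering of the torus: \<open>\<sigma> (\<theta> x)\<close> differs from \<open>w x\<close> by an integer vector\<close>
  define \<sigma> :: "complex ^ 'n \<Rightarrow> real ^ 'n" where "\<sigma> z = (\<chi> i. Arg (z $ i) / (2 * pi))" for z
  have wi[measurable]: "(\<lambda>x. w x $ i) \<in> borel_measurable M" for i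
  proof -
    have "(\<lambda>x. w x \<bullet> axis i 1) \<in> borel_measurable M" by measurable
    then show ?thesis by (simp add: inner_axis)
  qed
  have int_cis: "integrable M (\<lambda>x. h x * cis (2 * pi * (k \<bullet> w x)))" if "integrable M h" for h k
    using that borel_measurable_integrable[OF that]
    by (intro Bochner_Integration.integrable_bound[OF that]) (auto simp: norm_mult)
  have vec_meas: "F \<in> borel_measurable M'" if "\<And>i. (\<lambda>x. F x $ i) \<in> borel_measurable M'" for F :: "'z \<Rightarrow> ('q::euclidean_space) ^ 'n" and M'
  proof (subst borel_measurable_euclidean_space, rule ballI)
    fix b :: "'q ^ 'n" assume "b \<in> Basis"
    then obtain i u where b: "b = axis i u" by (auto simp: Basis_vec_def)
    show "(\<lambda>x. F x \<bullet> b) \<in> borel_measurable M'" unfolding b inner_axis using that[of i] by measurable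
  qed
  have \<theta>_meas: "\<theta> \<in> borel_measurable M" unfolding \<theta>_def by (rule vec_meas) (simp, measurable)
  have "\<sigma> \<in> borel_measurable borel" unfolding \<sigma>_def
  proof (rule vec_meas)
    fix i
    have "(\<lambda>z::complex^'n. z $ i) \<in> borel_measurable borel"
      by (intro borel_measurable_continuous_onI continuous_intros)
    then show "(\<lambda>z::complex^'n. (\<chi> i. Arg (z $ i) / (2 * pi)) $ i) \<in> borel_measurable borel"
      by simp measurable
  qed
  then have B': "\<sigma> -` B \<in> sets borel" using measurable_sets_borel[OF _ B] by blast
  have eq: "\<theta> x \<in> \<sigma> -` B \<longleftrightarrow> w x \<in> B" for x
  proof -
    have "\<exists>n::int. \<sigma> (\<theta> x) $ i = w x $ i + n" for i
    proof -
      have "cis (2 * pi * w x $ i) = cis (Arg (\<theta> x $ i))"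
        by (subst cis_Arg) (auto simp: \<theta>_def sgn_div_norm)
      then obtain n :: int where "2 * pi * w x $ i = Arg (\<theta> x $ i) + 2 * pi * n"
        using sin_cos_eq_iff by (auto simp: complex_eq_iff)
      then have "\<sigma> (\<theta> x) $ i = w x $ i + of_int (- n)" by (simp add: \<sigma>_def field_simps)
      then show ?thesis by blast
    qed
    then have "\<sigma> (\<theta> x) - w x \<in> int_points"
      by (auto simp: int_points_def) (metis Ints_of_int add_diff_cancel_left')
    from periodic[OF this, of "w x"] show ?thesis by simp
  qed
  have "(LINT x|M. of_real (indicator (\<sigma> -` B) (\<theta> x)) * H x) = 0"
  proof (rule integral_indicator_eq_0_if_moments_eq_0[where C = C and r = "real CARD('n)"])
    show "H \<in> C" using H zero by (simp add: C_def)
    show "integrable M h \<and> integral\<^sup>L M h = 0" if "h \<in> C" for h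
      using that int_points_0 unfolding C_def by (auto dest: bspec[where x=0])
    show "(\<lambda>x. h x + k x) \<in> C" if "h \<in> C" "k \<in> C" for h k
      using that by (auto simp: C_def distrib_right int_cis)
    show "(\<lambda>x. c * h x) \<in> C" if "h \<in> C" for h c
      using that by (auto simp: C_def mult.assoc)
    show "(\<lambda>x. of_real (\<theta> x \<bullet> b) * h x) \<in> C" if h: "h \<in> C" and b: "b \<in> Basis" for h b
    proof -
      obtain i u where b: "b = axis i u" "u = 1 \<or> u = \<i>"
        using b by (auto simp: Basis_vec_def Basis_complex_def)
      have ih: "integrable M h" using h by (simp add: C_def)
      \<comment> \<open>\<open>cos x = (cis x + cis (-x)) / 2\<close> and \<open>sin x = (cis x - cis (-x)) / (2 * \<i>)\<close>\<close>
      define c where "c = (if u = 1 then 1/2 else 1/(2*\<i>))"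
      define c' where "c' = (if u = 1 then 1/2 else -1/(2*\<i>))"
      have coo: "complex_of_real (\<theta> x \<bullet> b) = c * cis (2 * pi * (axis i 1 \<bullet> w x)) + c' * cis (2 * pi * ((- axis i 1) \<bullet> w x))" for x
        using b(2) by (auto simp: b(1) inner_axis inner_axis' \<theta>_def c_def c'_def complex_eq_iff inner_complex_def)
      have eq2: "complex_of_real (\<theta> x \<bullet> b) * h x * cis (2 * pi * (k \<bullet> w x))
          = c * (h x * cis (2 * pi * ((k + axis i 1) \<bullet> w x))) + c' * (h x * cis (2 * pi * ((k - axis i 1) \<bullet> w x)))" for x k
        unfolding coo by (simp add: inner_add_left inner_diff_left algebra_simps cis_mult)
      have "integrable M (\<lambda>x. complex_of_real (\<theta> x \<bullet> b) * h x * cis (2 * pi * (0 \<bullet> w x)))"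
        unfolding eq2 by (intro Bochner_Integration.integrable_add integrable_mult_right int_cis ih)
      moreover have "(LINT x|M. complex_of_real (\<theta> x \<bullet> b) * h x * cis (2 * pi * (k \<bullet> w x))) = 0" if k: "k \<in> int_points" for k
      proof -
        have "(LINT x|M. h x * cis (2 * pi * ((k + axis i 1) \<bullet> w x))) = 0"
          "(LINT x|M. h x * cis (2 * pi * ((k - axis i 1) \<bullet> w x))) = 0"
          using h int_points_add[OF k int_points_axis] int_points_diff[OF k int_points_axis] unfolding C_def by auto
        then show ?thesis
          unfolding eq2 by (subst Bochner_Integration.integral_add) (simp_all add: int_cis ih)
      qed
      ultimately show ?thesis by (simp add: C_def)
    qed
    show "norm (\<theta> x) \<le> real CARD('n)" for x
    proof -
      have "norm (\<theta> x) \<le> (\<Sum>i\<in>UNIV. norm (\<theta> x $ i))"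
        by (simp add: norm_vec_def L2_set_le_sum)
      then show ?thesis by (simp add: \<theta>_def)
    qed
  qed (use \<theta>_meas B' in auto)
  then show ?thesis using eq by (simp add: indicator_def)
qed

text \<open>
  Restricting \<open>\<omega>\<close> to the points \<open>k / n\<close> with \<open>k\<close> integral shows that \<open>H\<close> integrates to zero over every set of
  period \<open>n\<close> in each coordinate.  Periodizing the part of \<open>A\<close> in the ball of radius \<open>n / 3\<close> gives sets which,
  near any given point, agree with \<open>A\<close> once \<open>n\<close> is large.
\<close>

lemma fourier_uniqueness_L1:
  fixes H :: "real ^ 'n::finite \<Rightarrow> complex"
  assumes H: "integrable lborel H"
    and zero: "\<And>\<omega>. (LINT t|lborel. H t * cis (2 * pi * (\<omega> \<bullet> t))) = 0"
  shows "AE t in lborel. H t = 0"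
proof (rule sigma_finite_measure.density_zero[OF sigma_finite_lborel H])
  fix A :: "(real ^ 'n) set" assume "A \<in> sets lborel"
  then have A[measurable]: "A \<in> sets borel" by simp
  note [measurable] = borel_measurable_integrable[OF H]
  define A' where "A' n = A \<inter> cball 0 (real n / 3)" for n :: nat
  define B where "B n = (\<Union>k\<in>int_points. (\<lambda>v. real n *\<^sub>R (v - k)) -` A' n)" for n :: nat
  have [measurable]: "A' n \<in> sets borel" for n by (simp add: A'_def)
  have cnt: "countable (int_points :: (real ^ 'n) set)"
    by (rule countable_int_points)
  have [measurable]: "B n \<in> sets borel" for n unfolding B_def
  proof (rule sets.countable_UN''[OF cnt])
    fix k :: "real ^ 'n"
    have "(\<lambda>v. real n *\<^sub>R (v - k)) \<in> borel_measurable borel" by measurable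
    then show "(\<lambda>v. real n *\<^sub>R (v - k)) -` A' n \<in> sets borel"
      by (rule measurable_sets_borel) simp
  qed
  have per: "v + k \<in> B n \<longleftrightarrow> v \<in> B n" if k: "k \<in> int_points" for v k n
  proof
    assume "v + k \<in> B n"
    then obtain l where "l \<in> int_points" "real n *\<^sub>R (v + k - l) \<in> A' n" by (auto simp: B_def)
    then show "v \<in> B n" unfolding B_def
      using int_points_diff[of l k] k by (auto intro!: bexI[of _ "l - k"] simp: algebra_simps)
  next
    assume "v \<in> B n"
    then obtain l where "l \<in> int_points" "real n *\<^sub>R (v - l) \<in> A' n" by (auto simp: B_def)
    then show "v + k \<in> B n" unfolding B_def
      using int_points_add[of l k] k by (auto intro!: bexI[of _ "l + k"] simp: algebra_simps)
  qed
  have "(LINT t|lborel. of_real (indicator (B n) (t /\<^sub>R real n)) * H t) = 0" for n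
  proof (rule integer_characters_determine[OF H])
    fix k :: "real ^ 'n"
    show "(LINT t|lborel. H t * cis (2 * pi * (k \<bullet> (t /\<^sub>R real n)))) = 0"
      using zero[of "k /\<^sub>R real n"] by simp
  qed (use per in auto)
  moreover have "(\<lambda>n. LINT t|lborel. of_real (indicator (B n) (t /\<^sub>R real n)) * H t) \<longlonglongrightarrow> (LINT t|lborel. of_real (indicator A t) * H t)"
  proof (rule integral_dominated_convergence[where w="\<lambda>x. norm (H x)"])
    have "(\<lambda>n. indicator (B n) (t /\<^sub>R real n) :: real) \<longlonglongrightarrow> indicator A t" for t
    proof (rule tendsto_eventually)
      obtain n0 :: nat where n0: "real n0 > 3 * norm t" using reals_Archimedean2 by blast
      show "\<forall>\<^sub>F n in sequentially. indicator (B n) (t /\<^sub>R real n) = (indicator A t :: real)"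
        using eventually_ge_at_top[of n0] eventually_gt_at_top[of 0]
      proof eventually_elim
        case (elim n)
        have n: "real n > 3 * norm t" "n > 0" using elim n0 by linarith+
        have zero_only: "k = 0" if "k \<in> int_points" "t - real n *\<^sub>R k \<in> A' n" for k
        proof (rule ccontr)
          assume "k \<noteq> 0"
          then obtain i where i: "k $ i \<noteq> 0" by (auto simp: vec_eq_iff)
          have "k $ i \<in> \<int>" using that by (auto simp: int_points_def)
          with i have "1 \<le> \<bar>k $ i\<bar>" by (rule Ints_nonzero_abs_ge1[rotated])
          also have "\<dots> \<le> norm k" by (rule component_le_norm_cart)
          finally have "real n \<le> norm (real n *\<^sub>R k)" using mult_left_mono[of 1 "norm k" "real n"] by simp
          also have "\<dots> \<le> norm t + norm (t - real n *\<^sub>R k)"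
            using norm_triangle_ineq4[of t "t - real n *\<^sub>R k"] by simp
          also have "\<dots> \<le> norm t + real n / 3" using that by (simp add: A'_def)
          finally show False using n by linarith
        qed
        have "t /\<^sub>R real n \<in> B n \<longleftrightarrow> (\<exists>k\<in>int_points. t - real n *\<^sub>R k \<in> A' n)"
          using n by (simp add: B_def scaleR_diff_right)
        also have "\<dots> \<longleftrightarrow> t \<in> A' n" using zero_only int_points_0 by (metis diff_zero scaleR_zero_right)
        also have "\<dots> \<longleftrightarrow> t \<in> A" using n by (auto simp: A'_def)
        finally show ?case by (simp add: indicator_def)
      qed
    qed
    then show "AE t in lborel. (\<lambda>n. complex_of_real (indicator (B n) (t /\<^sub>R real n)) * H t) \<longlonglongrightarrow> complex_of_real (indicator A t) * H t"
      by (intro AE_I2 tendsto_intros tendsto_of_real)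
  qed (use H in \<open>auto simp: norm_mult intro!: AE_I2 mult_left_le_one_le\<close>)
  ultimately have "(LINT t|lborel. of_real (indicator A t) * H t) = 0"
    by (simp add: LIMSEQ_const_iff)
  then show "(LINT t:A|lborel. H t) = 0" by (simp add: set_lebesgue_integral_def scaleR_conv_of_real)
qed

section \<open>Zeros of Fourier integrals of compactly supported functions\<close>

text \<open>
  Expanding the exponential and integrating term by term gives a power series in \<open>z\<close> that converges
  everywhere; boundedness of \<open>u\<close> where \<open>h\<close> does not vanish provides the domination.
\<close>

lemma exponential_integral_entire:
  fixes h :: "'x \<Rightarrow> complex" and u :: "'x \<Rightarrow> real"
  assumes h: "integrable M h" and u[measurable]: "u \<in> borel_measurable M"
    and R: "\<And>s. h s \<noteq> 0 \<Longrightarrow> \<bar>u s\<bar> \<le> R" and R0: "R \<ge> 0"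
  shows "(\<lambda>z. LINT s|M. h s * exp (\<i> * of_real (u s) * z)) holomorphic_on UNIV"
proof -
  note [measurable] = borel_measurable_integrable[OF h]
  define a where "a n = (LINT s|M. h s * ((\<i> * of_real (u s)) ^ n / fact n))" for n
  have sums: "(\<lambda>n. a n * (z - 0) ^ n) sums (LINT s|M. h s * exp (\<i> * of_real (u s) * z))" for z
  proof -
    define f where "f n s = h s * ((\<i> * of_real (u s) * z) ^ n /\<^sub>R fact n)" for n s
    have bound: "norm (f n s) \<le> ((R * norm z) ^ n /\<^sub>R fact n) * norm (h s)" for n s
    proof (cases "h s = 0")
      case False
      have "\<bar>u s\<bar> * norm z \<le> R * norm z" using R[OF False] by (intro mult_right_mono) auto
      then have "(\<bar>u s\<bar> * norm z) ^ n \<le> (R * norm z) ^ n" by (intro power_mono) auto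
      then have "norm (h s) * (\<bar>u s\<bar> * norm z) ^ n / fact n \<le> norm (h s) * (R * norm z) ^ n / fact n"
        by (intro divide_right_mono mult_left_mono) auto
      then show ?thesis
        by (simp add: f_def norm_mult norm_power divide_simps mult_ac)
    qed (simp add: f_def)
    have summ: "summable (\<lambda>n. (R * norm z) ^ n /\<^sub>R fact n)" by (rule summable_exp_generic)
    have int: "integrable M (f n)" for n
    proof (rule Bochner_Integration.integrable_bound[where f = "\<lambda>s. ((R * norm z) ^ n /\<^sub>R fact n) * norm (h s)"])
      show "AE s in M. norm (f n s) \<le> norm (((R * norm z) ^ n /\<^sub>R fact n) * norm (h s))"
        using bound R0 by (intro AE_I2) (simp add: order_trans[OF _ abs_ge_self])
      show "f n \<in> borel_measurable M" unfolding f_def by measurable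
    qed (use h in auto)
    have "(\<lambda>n. integral\<^sup>L M (f n)) sums (LINT s|M. (\<Sum>n. f n s))"
    proof (rule sums_integral[OF int])
      show "AE s in M. summable (\<lambda>n. norm (f n s))"
        by (intro AE_I2 summable_comparison_test'[OF summable_mult2[OF summ], of 0 _ _ ]) (use bound in auto)
      show "summable (\<lambda>n. LINT s|M. norm (f n s))"
      proof (rule summable_comparison_test'[OF summable_mult2[OF summ], of 0])
        fix n :: nat
        have "(LINT s|M. norm (f n s)) \<le> (LINT s|M. ((R * norm z) ^ n /\<^sub>R fact n) * norm (h s))"
          by (intro integral_mono bound) (use int h in auto)
        then show "norm (LINT s|M. norm (f n s)) \<le> ((R * norm z) ^ n /\<^sub>R fact n) * (LINT s|M. norm (h s))"
          by simp
      qed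
    qed
    moreover have "(\<Sum>n. f n s) = h s * exp (\<i> * of_real (u s) * z)" for s
      unfolding f_def exp_def by (intro suminf_mult summable_exp_generic)
    moreover have "integral\<^sup>L M (f n) = a n * (z - 0) ^ n" for n
    proof -
      have "f n s = h s * ((\<i> * of_real (u s)) ^ n / fact n) * z ^ n" for s
        by (simp add: f_def power_mult_distrib scaleR_conv_of_real divide_simps)
      then have "integral\<^sup>L M (f n) = (LINT s|M. h s * ((\<i> * of_real (u s)) ^ n / fact n) * z ^ n)" by presburger
      also have "\<dots> = a n * z ^ n" unfolding a_def by (rule integral_mult_left_zero)
      finally show ?thesis by simp
    qed
    ultimately show ?thesis by simp
  qed
  have "(\<lambda>z. LINT s|M. h s * exp (\<i> * of_real (u s) * z)) holomorphic_on ball 0 r" for r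
    by (rule power_series_holomorphic[where a = a]) (rule sums)
  then have "(\<lambda>z. LINT s|M. h s * exp (\<i> * of_real (u s) * z)) holomorphic_on (\<Union>r\<in>UNIV. ball 0 r)"
    by (intro holomorphic_on_UN_open) auto
  moreover have "(\<Union>r\<in>UNIV. ball (0::complex) r) = UNIV"
    by (auto intro: gt_ex)
  ultimately show ?thesis by simp
qed

text \<open>
  The Fourier integral is nonzero at some point \<open>p\<close>, since otherwise \<open>h\<close> would be zero almost everywhere.
  Along each line through \<open>p\<close> it is the restriction of an entire function, so its zeros there are
  countable.  By Fubini there is some \<open>r \<noteq> 0\<close> such that almost every \<open>v\<close> gives a nonzero value at \<open>p + r v\<close>, and
  \<open>v \<mapsto> p + r v\<close> preserves null sets.
\<close>

lemma AE_fourier_integral_neq_0: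
  fixes h :: "real ^ 'n::finite \<Rightarrow> complex"
  assumes h: "integrable lborel h" and R: "\<And>s. h s \<noteq> 0 \<Longrightarrow> norm s \<le> R"
    and nz: "\<not> (AE s in lborel. h s = 0)"
  shows "AE \<omega> in lborel. (LINT s|lborel. h s * cis (2 * pi * (\<omega> \<bullet> s))) \<noteq> 0"
proof -
  note [measurable] = borel_measurable_integrable[OF h]
  define F where "F \<omega> = (LINT s|lborel. h s * cis (2 * pi * (\<omega> \<bullet> s)))" for \<omega>
  have F_meas[measurable]: "F \<in> borel_measurable borel"
    unfolding F_def by measurable
  obtain p where p: "F p \<noteq> 0" using fourier_uniqueness_L1[OF h] nz unfolding F_def by blast
  have line: "AE r in lborel. F (p + r *\<^sub>R v) \<noteq> 0" for v
  proof -
    define g where "g z = (LINT s|lborel. (h s * cis (2 * pi * (p \<bullet> s))) * exp (\<i> * of_real (2 * pi * (v \<bullet> s)) * z))" for z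
    have g: "g (of_real r) = F (p + r *\<^sub>R v)" for r
    proof -
      have "cis (2 * pi * ((p + r *\<^sub>R v) \<bullet> s)) = cis (2 * pi * (p \<bullet> s)) * exp (\<i> * of_real (2 * pi * (v \<bullet> s)) * of_real r)" for s
        unfolding cis_conv_exp exp_add[symmetric] by (simp add: inner_add_left algebra_simps)
      then show ?thesis unfolding g_def F_def by (simp add: mult.assoc)
    qed
    have "g holomorphic_on UNIV" unfolding g_def
    proof (rule exponential_integral_entire[where R = "2 * pi * (norm v * \<bar>R\<bar>)"])
      show "integrable lborel (\<lambda>s. h s * cis (2 * pi * (p \<bullet> s)))"
        by (rule Bochner_Integration.integrable_bound[OF h]) (auto simp: norm_mult)
      show "\<bar>2 * pi * (v \<bullet> s)\<bar> \<le> 2 * pi * (norm v * \<bar>R\<bar>)" if "h s * cis (2 * pi * (p \<bullet> s)) \<noteq> 0" for s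
      proof -
        have "h s \<noteq> 0" using that by auto
        from R[OF this] have "norm v * norm s \<le> norm v * \<bar>R\<bar>" by (intro mult_left_mono) auto
        then have "\<bar>v \<bullet> s\<bar> \<le> norm v * \<bar>R\<bar>" using Cauchy_Schwarz_ineq2[of v s] by linarith
        then show ?thesis by (simp add: abs_mult)
      qed
    qed auto
    have "countable {z. g z = 0}"
    proof (cases "g constant_on UNIV")
      case True
      then have "g z = F p" for z using g[of 0] by (auto simp: constant_on_def)
      then show ?thesis using p by simp
    next
      case False
      have "countable {z \<in> UNIV. g z = 0}"
        by (rule holomorphic_countable_zeros[OF \<open>g holomorphic_on UNIV\<close> _ _ _ False]) (auto simp: fsigma_UNIV)
      then show ?thesis by simp
    qed
    then have "countable (complex_of_real -` {z. g z = 0})"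
      by (intro countable_image_inj_on[of complex_of_real] countable_subset[of "complex_of_real ` _"] inj_onI) auto
    then have "countable {r. F (p + r *\<^sub>R v) = 0}" by (simp add: g vimage_def)
    then have "{r. F (p + r *\<^sub>R v) = 0} \<in> null_sets lborel" by (rule countable_imp_null_set_lborel)
    then show ?thesis by (rule AE_I') auto
  qed
  have "AE v in lborel. AE r in lborel. F (p + r *\<^sub>R v) \<noteq> 0" using line by simp
  then have "AE r in lborel. AE v in lborel. F (p + r *\<^sub>R v) \<noteq> 0"
    by (subst lborel_pair.AE_commute) measurable
  moreover have "AE r::real in lborel. r \<noteq> 0" by (rule AE_lborel_singleton)
  ultimately have "AE r in lborel. r \<noteq> 0 \<and> (AE v in lborel. F (p + r *\<^sub>R v) \<noteq> 0)"
    by (intro eventually_conj)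
  then have "\<exists>r::real. r \<noteq> 0 \<and> (AE v in lborel. F (p + r *\<^sub>R v) \<noteq> 0)"
    by (rule eventually_happens'[rotated]) (simp add: ae_filter_eq_bot_iff)
  then obtain r :: real where r: "r \<noteq> 0" "AE v in lborel. F (p + r *\<^sub>R v) \<noteq> 0" by blast
  have "AE \<omega> in density (distr lborel borel (\<lambda>v. p + r *\<^sub>R v)) (\<lambda>_. \<bar>r\<bar> ^ DIM(real ^ 'n)). F \<omega> \<noteq> 0"
    using r(2) by (simp add: AE_density AE_distr_iff)
  then have "AE \<omega> in lborel. F \<omega> \<noteq> 0" by (subst lborel_affine[OF r(1), of p])
  then show ?thesis unfolding F_def .
qed

section \<open>Square-integrable functions and Gaussians\<close>

lemma integrable_tensor:
  fixes f :: "'a::euclidean_space \<Rightarrow> complex" and g :: "'b::euclidean_space \<Rightarrow> complex"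
  assumes f: "integrable lborel f" and g: "integrable lborel g"
  shows "integrable (lborel \<Otimes>\<^sub>M lborel) (\<lambda>(x, y). f x * g y)"
proof -
  note [measurable] = borel_measurable_integrable[OF f] borel_measurable_integrable[OF g]
  show ?thesis
    by (rule lborel_pair.Fubini_integrable) (use f g in \<open>auto simp: norm_mult\<close>)
qed

lemma integrable_times_cis:
  assumes "integrable M f" and [measurable]: "u \<in> borel_measurable M"
  shows "integrable M (\<lambda>x. f x * cis (u x))"
  using borel_measurable_integrable[OF assms(1)]
  by (intro Bochner_Integration.integrable_bound[OF assms(1)]) (auto simp: norm_mult)

lemma integrable_mult_L2:
  fixes u v :: "'x \<Rightarrow> complex"
  assumes [measurable]: "u \<in> borel_measurable M" "v \<in> borel_measurable M"
    and "integrable M (\<lambda>x. (norm (u x))\<^sup>2)" "integrable M (\<lambda>x. (norm (v x))\<^sup>2)"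
  shows "integrable M (\<lambda>x. u x * v x)"
proof (rule Bochner_Integration.integrable_bound)
  show "integrable M (\<lambda>x. (norm (u x))\<^sup>2 + (norm (v x))\<^sup>2)" using assms by simp
  have "a * b \<le> a\<^sup>2 + b\<^sup>2" if "a \<ge> 0" "b \<ge> 0" for a b :: real
    using sum_squares_bound[of a b] mult_nonneg_nonneg[OF that] by linarith
  then show "AE x in M. norm (u x * v x) \<le> norm ((norm (u x))\<^sup>2 + (norm (v x))\<^sup>2)"
    by (intro AE_I2) (simp add: norm_mult)
qed simp

text \<open>
  By the Cauchy-Schwarz inequality, pairing with a fixed square-integrable \<open>v\<close> is continuous in the \<open>L^2\<close> distance.
\<close>

lemma tendsto_integral_mult_L2:
  fixes u :: "'x \<Rightarrow> complex"
  assumes [measurable]: "\<And>n. U n \<in> borel_measurable M" "u \<in> borel_measurable M" "v \<in> borel_measurable M"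
    and v: "integrable M (\<lambda>x. (norm (v x))\<^sup>2)"
    and int: "\<And>n. integrable M (\<lambda>x. U n x * v x)" "integrable M (\<lambda>x. u x * v x)"
    and lim: "(\<lambda>n. \<integral>\<^sup>+ x. ennreal ((norm (U n x - u x))\<^sup>2) \<partial>M) \<longlonglongrightarrow> 0"
  shows "(\<lambda>n. LINT x|M. U n x * v x) \<longlonglongrightarrow> (LINT x|M. u x * v x)"
proof -
  define V where "V = (\<integral>\<^sup>+ x. ennreal ((norm (v x))\<^sup>2) \<partial>M)"
  have V: "V < \<infinity>" using v unfolding V_def by (subst nn_integral_eq_integral) auto
  define d where "d n = norm ((LINT x|M. U n x * v x) - (LINT x|M. u x * v x))" for n
  have le: "ennreal ((d n)\<^sup>2) \<le> (\<integral>\<^sup>+ x. ennreal ((norm (U n x - u x))\<^sup>2) \<partial>M) * V" for n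
  proof -
    have "d n = norm (LINT x|M. (U n x - u x) * v x)"
      unfolding d_def using int by (simp add: left_diff_distrib)
    also have "ennreal \<dots> \<le> (\<integral>\<^sup>+ x. norm ((U n x - u x) * v x) \<partial>M)"
      using int by (intro integral_norm_bound_ennreal) (simp add: left_diff_distrib)
    also have "\<dots> = (\<integral>\<^sup>+ x. ennreal (norm (U n x - u x)) * ennreal (norm (v x)) \<partial>M)"
      by (simp add: norm_mult ennreal_mult)
    finally have "(ennreal (d n))\<^sup>2 \<le> \<dots>\<^sup>2" by (rule power_mono) simp
    also have "\<dots> \<le> (\<integral>\<^sup>+ x. (ennreal (norm (U n x - u x)))\<^sup>2 \<partial>M) * (\<integral>\<^sup>+ x. (ennreal (norm (v x)))\<^sup>2 \<partial>M)"
      by (rule Cauchy_Schwarz_nn_integral) auto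
    finally show ?thesis by (simp add: V_def ennreal_power d_def)
  qed
  have lim': "(\<lambda>n. V * (\<integral>\<^sup>+ x. ennreal ((norm (U n x - u x))\<^sup>2) \<partial>M)) \<longlonglongrightarrow> 0"
    using ennreal_tendsto_cmult[OF _ lim, of V] V by simp
  have "(\<lambda>n. ennreal ((d n)\<^sup>2)) \<longlonglongrightarrow> 0"
    by (rule tendsto_sandwich[OF _ _ tendsto_const lim']) (use le in \<open>auto simp: mult.commute\<close>)
  then have "(\<lambda>n. (d n)\<^sup>2) \<longlonglongrightarrow> 0"
    by (rule ennreal_tendsto_0_iff[THEN iffD1, rotated]) simp
  then have "(\<lambda>n. d n) \<longlonglongrightarrow> 0"
    using tendsto_real_sqrt[of "\<lambda>n. (d n)\<^sup>2" 0] by (simp add: d_def)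
  then show ?thesis unfolding d_def using LIM_zero_cancel tendsto_norm_zero_iff by blast
qed

definition gaussian :: "'a::euclidean_space \<Rightarrow> complex" where
  "gaussian t = of_real (exp (- (pi * (norm t)\<^sup>2)))"

text \<open>
  This is the characteristic function of the standard normal distribution after the substitution
  \<open>x \<mapsto> sqrt (2 * pi) * x\<close>.
\<close>

lemma gaussian_real_fourier:
  fixes y :: real
  shows "has_bochner_integral lborel (\<lambda>x. of_real (exp (- (pi * x\<^sup>2))) * cis (2 * pi * (y * x))) (complex_of_real (exp (- (pi * y\<^sup>2))))"
proof -
  define c where "c = sqrt (2 * pi)"
  have c: "c > 0" "c\<^sup>2 = 2 * pi" by (auto simp: c_def)
  define F where "F x = std_normal_density x *\<^sub>R iexp (c * y * x)" for x :: real
  have int: "integrable lborel F" unfolding F_def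
  proof (rule Bochner_Integration.integrable_bound)
    show "integrable lborel std_normal_density" by simp
  qed auto
  have "(LINT x|lborel. F x) = char std_normal_distribution (c * y)"
    unfolding char_def F_def by (subst integral_density) auto
  also have "\<dots> = of_real (exp (- (pi * y\<^sup>2)))"
    by (simp add: char_std_normal_distribution power_mult_distrib c)
  finally have val: "(LINT x|lborel. F x) = of_real (exp (- (pi * y\<^sup>2)))" .
  have F: "c *\<^sub>R F (0 + c * x) = of_real (exp (- (pi * x\<^sup>2))) * cis (2 * pi * (y * x))" for x
  proof -
    have "c * std_normal_density (c * x) = exp (- (pi * x\<^sup>2))"
      using c by (simp add: std_normal_density_def power_mult_distrib c_def[symmetric])
    moreover have "c * y * (c * x) = 2 * pi * (y * x)" using c(2) by (simp add: power2_eq_square mult_ac)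
    moreover have "c *\<^sub>R F (0 + c * x) = of_real (c * std_normal_density (c * x)) * cis (c * y * (c * x))"
      by (simp add: F_def cis_conv_exp scaleR_conv_of_real mult_ac)
    ultimately show ?thesis by presburger
  qed
  have "integrable lborel (\<lambda>x. c *\<^sub>R F (0 + c * x))"
    using lborel_integrable_real_affine[OF int, of c 0] c by simp
  moreover have "(LINT x|lborel. c *\<^sub>R F (0 + c * x)) = of_real (exp (- (pi * y\<^sup>2)))"
    using lborel_integral_real_affine[of c F 0] c val by simp
  ultimately show ?thesis unfolding F by (simp add: has_bochner_integral_iff)
qed

text \<open>
  The integrand is a product of one-dimensional functions of the coordinates.
\<close>

lemma gaussian_fourier:
  fixes \<omega> :: "'a::euclidean_space"
  shows "has_bochner_integral lborel (\<lambda>t. gaussian t * cis (2 * pi * (\<omega> \<bullet> t))) (gaussian \<omega>)"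
proof -
  interpret product_sigma_finite "\<lambda>_::'a. lborel :: real measure" ..
  define e where "e b x = of_real (exp (- (pi * x\<^sup>2))) * cis (2 * pi * ((\<omega> \<bullet> b) * x))" for b :: 'a and x :: real
  have e: "has_bochner_integral lborel (e b) (of_real (exp (- (pi * (\<omega> \<bullet> b)\<^sup>2))))" for b
    unfolding e_def by (rule gaussian_real_fourier)
  have g: "gaussian t = (\<Prod>b\<in>Basis. of_real (exp (- (pi * (t \<bullet> b)\<^sup>2))))" for t :: 'a
    unfolding gaussian_def power2_norm_eq_inner euclidean_inner[of t t]
    by (simp add: sum_distrib_left power2_eq_square flip: exp_sum sum_negf of_real_prod)
  have cis_sum: "cis (\<Sum>b\<in>A. f b) = (\<Prod>b\<in>A. cis (f b))" if "finite A" for A and f :: "'a \<Rightarrow> real"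
    using that by (induction A) (auto simp: cis_mult[symmetric])
  have prod: "gaussian t * cis (2 * pi * (\<omega> \<bullet> t)) = (\<Prod>b\<in>Basis. e b (t \<bullet> b))" for t
    unfolding e_def prod.distrib g euclidean_inner[of \<omega> t]
    by (simp add: sum_distrib_left cis_sum)
  define T where "T f = (\<Sum>b\<in>Basis. f b *\<^sub>R b)" for f :: "'a \<Rightarrow> real"
  have T: "T f \<bullet> b = f b" if "b \<in> Basis" for f b
    unfolding T_def using that by simp
  have Tm: "T \<in> (\<Pi>\<^sub>M b\<in>Basis. lborel) \<rightarrow>\<^sub>M borel" unfolding T_def by measurable
  have gm: "(\<lambda>t. gaussian t * cis (2 * pi * (\<omega> \<bullet> t))) \<in> borel_measurable borel"
    unfolding gaussian_def by measurable
  have eq: "gaussian (T f) * cis (2 * pi * (\<omega> \<bullet> T f)) = (\<Prod>b\<in>Basis. e b (f b))" for f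
    unfolding prod by (intro prod.cong refl) (simp add: T)
  have "integrable (\<Pi>\<^sub>M b\<in>Basis. lborel) (\<lambda>f. \<Prod>b\<in>Basis. e b (f b))"
    by (rule product_integrable_prod) (use e in \<open>auto simp: has_bochner_integral_iff\<close>)
  moreover have "(LINT f|(\<Pi>\<^sub>M b\<in>Basis. lborel). (\<Prod>b\<in>Basis. e b (f b))) = gaussian \<omega>"
    using e by (subst product_integral_prod) (auto simp: has_bochner_integral_iff g)
  ultimately show ?thesis
    unfolding has_bochner_integral_iff lborel_eq[where 'a = 'a] T_def[symmetric]
    by (simp add: integrable_distr_eq[OF Tm gm] integral_distr[OF Tm gm] eq)
qed

text \<open>
  Products of Lebesgue measures are not complete, so Fubini arguments need Borel representatives of Lebesgue
  measurable functions.
\<close>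

lemma lebesgue_ex_borel:
  fixes f :: "'a::euclidean_space \<Rightarrow> complex"
  assumes "f \<in> borel_measurable lebesgue"
  obtains f' where "f' \<in> borel_measurable borel" "AE x in lborel. f x = f' x"
proof -
  have "(\<lambda>x. Re (f x)) \<in> borel_measurable lebesgue" "(\<lambda>x. Im (f x)) \<in> borel_measurable lebesgue"
    using assms by measurable
  from this[THEN completion_ex_borel_measurable_real] obtain a b
    where [measurable]: "a \<in> borel_measurable lborel" "b \<in> borel_measurable lborel"
      and "AE x in lborel. Re (f x) = a x" "AE x in lborel. Im (f x) = b x" by blast
  have "AE x in lborel. f x = Complex (a x) (b x)"
    using \<open>AE x in lborel. Re (f x) = a x\<close> \<open>AE x in lborel. Im (f x) = b x\<close>
    by eventually_elim (simp add: complex_eq_iff)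
  moreover have "(\<lambda>x. Complex (a x) (b x)) \<in> borel_measurable borel"
    unfolding Complex_eq by measurable
  ultimately show ?thesis using that by blast
qed

lemma lebesgue_measurable_AE:
  fixes f f' :: "'a::euclidean_space \<Rightarrow> complex"
  assumes f': "f' \<in> borel_measurable borel" and ae: "AE x in lborel. f x = f' x"
  shows "f \<in> borel_measurable lebesgue"
proof (rule borel_measurableI)
  fix S :: "complex set" assume "open S"
  have "f' \<in> borel_measurable lebesgue" using f' by (simp add: measurable_completion)
  then have "f' -` S \<in> sets lebesgue" using measurable_sets[of f' lebesgue borel S] \<open>open S\<close> by simp
  moreover have "AE x in lebesgue. x \<in> f' -` S \<longleftrightarrow> x \<in> f -` S"
    using ae unfolding AE_completion_iff by eventually_elim simp
  ultimately show "f -` S \<inter> space lebesgue \<in> sets lebesgue"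
    using completion.in_sets_AE[of "f' -` S" "f -` S" lborel] by simp
qed

lemma lebesgue_integral_cong_lborel:
  fixes f f' :: "'a::euclidean_space \<Rightarrow> complex"
  assumes f': "f' \<in> borel_measurable borel" and ae: "AE x in lborel. f x = f' x"
  shows "integral\<^sup>L lebesgue f = integral\<^sup>L lborel f'"
proof -
  have "integral\<^sup>L lebesgue f = integral\<^sup>L lebesgue f'"
    using lebesgue_measurable_AE[OF f' ae] f' ae
    by (intro integral_cong_AE) (auto simp: measurable_completion AE_completion_iff)
  also have "\<dots> = integral\<^sup>L lborel f'"
    using f' by (intro integral_completion) simp
  finally show ?thesis .
qed

section \<open>Fourier inversion for compactly supported spectra\<close>

text \<open>
  The complement of the essential support is a union of open sets on which \<open>f\<close> is zero almost everywhere, and by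
  the Lindelof property countably many of them suffice.
\<close>

lemma AE_eq_0_outside_support:
  fixes f :: "'a::euclidean_space \<Rightarrow> complex"
  assumes "ess_support f \<subseteq> K"
  shows "AE x in lborel. x \<notin> K \<longrightarrow> f x = 0"
proof -
  define \<V> where "\<V> = {V. open V \<and> (AE t in lebesgue. t \<in> V \<longrightarrow> f t = 0)}"
  obtain \<W> where \<W>: "\<W> \<subseteq> \<V>" "countable \<W>" "\<Union>\<W> = \<Union>\<V>"
    by (rule Lindelof[of \<V>]) (auto simp: \<V>_def)
  have "AE t in lebesgue. \<forall>V\<in>\<W>. t \<in> V \<longrightarrow> f t = 0"
    using \<W> by (subst AE_ball_countable) (auto simp: \<V>_def)
  moreover have "\<exists>V\<in>\<W>. x \<in> V" if "x \<notin> K" for x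
  proof -
    have "x \<notin> ess_support f" using assms that by blast
    then have "x \<in> \<Union>\<V>" by (auto simp: ess_support_def \<V>_def)
    then show ?thesis using \<W> by blast
  qed
  ultimately show ?thesis
    unfolding AE_completion_iff by (auto elim!: eventually_mono)
qed

lemma integrable_if_L2_bounded_support:
  fixes f :: "'a::euclidean_space \<Rightarrow> complex"
  assumes [measurable]: "f \<in> borel_measurable borel"
    and f: "integrable lborel (\<lambda>x. (norm (f x))\<^sup>2)"
    and K: "bounded K" "\<And>x. x \<notin> K \<Longrightarrow> f x = 0"
  shows "integrable lborel f"
proof -
  obtain R where R: "K \<subseteq> cball 0 R" using bounded_subset_ballD[OF K(1), of 0] ball_subset_cball by blast
  have ind: "integrable lborel (indicator (cball 0 R) :: 'a \<Rightarrow> real)"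
    using emeasure_bounded_finite[of "cball 0 R"] by (intro integrable_real_indicator) auto
  show ?thesis
  proof (rule Bochner_Integration.integrable_bound[OF Bochner_Integration.integrable_add[OF f ind]])
    have "norm (f x) \<le> (norm (f x))\<^sup>2 + indicator (cball 0 R) x" for x
    proof (cases "x \<in> K")
      case True
      have "norm (f x) * 1 \<le> (norm (f x))\<^sup>2 + 1"
        using sum_squares_bound[of "norm (f x)" 1] zero_le_power2[of "norm (f x)"] by (simp, linarith)
      then show ?thesis using True R by auto
    qed (use K in auto)
    then show "AE x in lborel. norm (f x) \<le> norm ((norm (f x))\<^sup>2 + indicator (cball 0 R) x)"
      by (intro AE_I2) (simp add: order_trans[OF _ abs_ge_self])
  qed simp
qed

lemma square_integrable_borel_cong:
  assumes f: "square_integrable f" and f'[measurable]: "f' \<in> borel_measurable borel" and ae: "AE x in lborel. f x = f' x"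
  shows "integrable lborel (\<lambda>x. (norm (f' x))\<^sup>2)"
proof -
  have "integrable lebesgue (\<lambda>x. (norm (f' x))\<^sup>2)"
  proof (rule integrable_cong_AE_imp)
    show "integrable lebesgue (\<lambda>x. (norm (f x))\<^sup>2)" using f by (simp add: square_integrable_def)
    show "(\<lambda>x. (norm (f' x))\<^sup>2) \<in> borel_measurable lebesgue"
      by (intro measurable_completion) simp
    show "AE x in lebesgue. (norm (f x))\<^sup>2 = (norm (f' x))\<^sup>2"
      using ae unfolding AE_completion_iff by eventually_elim simp
  qed
  then show ?thesis by (subst (asm) integrable_completion) auto
qed

lemma square_integrable_ex_borel:
  fixes f :: "'a::euclidean_space \<Rightarrow> complex"
  assumes f: "square_integrable f"
  obtains f' where "f' \<in> borel_measurable borel" "AE x in lborel. f x = f' x"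
    "integrable lborel (\<lambda>x. (norm (f' x))\<^sup>2)"
  using lebesgue_ex_borel[of f] square_integrable_borel_cong[OF f] f
  unfolding square_integrable_def by blast

lemma L2_on_ex_borel:
  fixes f :: "'a::euclidean_space \<Rightarrow> complex"
  assumes f: "square_integrable f" "ess_support f \<subseteq> K" and K: "compact K"
  obtains f' where "f' \<in> borel_measurable borel" "AE x in lborel. f x = f' x"
    "integrable lborel (\<lambda>x. (norm (f' x))\<^sup>2)" "integrable lborel f'" "\<And>x. x \<notin> K \<Longrightarrow> f' x = 0"
proof -
  obtain f1 where f1[measurable]: "f1 \<in> borel_measurable borel" and ae: "AE x in lborel. f x = f1 x"
    using square_integrable_ex_borel[OF f(1)] by blast
  define f' where "f' x = indicator K x *\<^sub>R f1 x" for x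
  have [measurable]: "K \<in> sets borel" using K by (simp add: borel_compact)
  have m: "f' \<in> borel_measurable borel" unfolding f'_def by measurable
  have ae': "AE x in lborel. f x = f' x"
    using ae AE_eq_0_outside_support[OF f(2)] by eventually_elim (auto simp: f'_def indicator_def)
  have sq: "integrable lborel (\<lambda>x. (norm (f' x))\<^sup>2)" by (rule square_integrable_borel_cong[OF f(1) m ae'])
  have z: "\<And>x. x \<notin> K \<Longrightarrow> f' x = 0" by (simp add: f'_def)
  show ?thesis
    by (rule that[OF m ae' sq integrable_if_L2_bounded_support[OF m sq compact_imp_bounded[OF K] z] z])
qed

lemma lborel_translate: "distr lborel borel (\<lambda>x. x + c) = (lborel :: 'a::euclidean_space measure)"
proof -
  have "(\<lambda>x. x + c) = (+) c" by (simp add: fun_eq_iff add.commute)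
  then show ?thesis by (simp add: lborel_distr_plus)
qed

lemma lborel_translate_minus: "distr lborel borel (\<lambda>x. x - c) = (lborel :: 'a::euclidean_space measure)"
  using lborel_translate[of "-c"] by simp

lemma borel_measurable_gaussian [measurable]: "gaussian \<in> borel_measurable borel"
  unfolding gaussian_def by measurable

lemma integrable_gaussian: "integrable lborel (gaussian :: 'a::euclidean_space \<Rightarrow> complex)"
  using gaussian_fourier[of "0::'a"] by (simp add: has_bochner_integral_iff)

lemma integral_gaussian_cis: "(LINT t|lborel. gaussian t * cis (2 * pi * (\<omega> \<bullet> t))) = gaussian (\<omega> :: 'a::euclidean_space)"
  using gaussian_fourier[of \<omega>] by (simp add: has_bochner_integral_iff)

lemma gaussian_minus [simp]: "gaussian (- t) = gaussian t"
  by (simp add: gaussian_def)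

lemma integrable_translate:
  fixes f :: "'a::euclidean_space \<Rightarrow> complex"
  assumes "integrable lborel f" shows "integrable lborel (\<lambda>x. f (x - c))"
proof -
  have "integrable (distr lborel borel (\<lambda>x. x - c)) f" using assms by (simp add: lborel_translate_minus)
  then show ?thesis by (subst (asm) integrable_distr_eq) (use assms in auto)
qed

lemma integral_translate:
  fixes f :: "'a::euclidean_space \<Rightarrow> complex"
  assumes [measurable]: "f \<in> borel_measurable borel"
  shows "(LINT x|lborel. f (x - c)) = (LINT x|lborel. f x)"
  by (subst (2) lborel_translate_minus[of c, symmetric]) (simp add: integral_distr)

text \<open>
  The identity \<open>\<integral> F\<phi> \<cdot> \<psi> = \<integral> \<phi> \<cdot> F\<psi>\<close> for the translated Gaussian \<open>\<psi>\<close>, whose transform is explicit.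
\<close>

lemma multiplication_formula_gaussian:
  fixes \<phi> :: "'a::euclidean_space \<Rightarrow> complex"
  assumes \<phi>: "integrable lborel \<phi>"
  shows "(LINT \<omega>|lborel. (LINT t|lborel. \<phi> t * cis (- (2 * pi * (\<omega> \<bullet> t)))) * gaussian (\<omega> - \<eta>))
    = (LINT t|lborel. \<phi> t * (gaussian t * cis (- (2 * pi * (\<eta> \<bullet> t)))))"
proof -
  note [measurable] = borel_measurable_integrable[OF \<phi>]
  have int: "integrable (lborel \<Otimes>\<^sub>M lborel) (\<lambda>(\<omega>, t). gaussian (\<omega> - \<eta>) * \<phi> t * cis (- (2 * pi * (\<omega> \<bullet> t))))"
    using integrable_times_cis[OF integrable_tensor[OF integrable_translate[OF integrable_gaussian] \<phi>], of "\<lambda>(\<omega>, t). - (2 * pi * (\<omega> \<bullet> t))"]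
    by (simp add: case_prod_unfold)
  have inner: "(LINT \<omega>|lborel. gaussian (\<omega> - \<eta>) * cis (- (2 * pi * (\<omega> \<bullet> t)))) = gaussian t * cis (- (2 * pi * (\<eta> \<bullet> t)))" for t
  proof -
    have "gaussian (\<omega> - \<eta>) * cis (- (2 * pi * (\<omega> \<bullet> t))) =
        gaussian (\<omega> - \<eta>) * cis (2 * pi * ((- t) \<bullet> (\<omega> - \<eta>))) * cis (- (2 * pi * (\<eta> \<bullet> t)))" for \<omega>
      by (simp add: mult.assoc cis_mult inner_diff_right inner_commute algebra_simps)
    then have "(LINT \<omega>|lborel. gaussian (\<omega> - \<eta>) * cis (- (2 * pi * (\<omega> \<bullet> t))))
      = (LINT \<omega>|lborel. gaussian (\<omega> - \<eta>) * cis (2 * pi * ((- t) \<bullet> (\<omega> - \<eta>))) * cis (- (2 * pi * (\<eta> \<bullet> t))))"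
      by (rule Bochner_Integration.integral_cong[OF refl])
    also have "\<dots> = (LINT \<omega>|lborel. gaussian (\<omega> - \<eta>) * cis (2 * pi * ((- t) \<bullet> (\<omega> - \<eta>)))) * cis (- (2 * pi * (\<eta> \<bullet> t)))"
      by (rule integral_mult_left_zero)
    also have "(LINT \<omega>|lborel. gaussian (\<omega> - \<eta>) * cis (2 * pi * ((- t) \<bullet> (\<omega> - \<eta>)))) = (LINT \<omega>|lborel. gaussian \<omega> * cis (2 * pi * ((- t) \<bullet> \<omega>)))"
      by (rule integral_translate[of "\<lambda>\<omega>. gaussian \<omega> * cis (2 * pi * ((- t) \<bullet> \<omega>))"]) measurable
    also have "\<dots> = gaussian t" using integral_gaussian_cis[of "-t"] by simp
    finally show ?thesis .
  qed
  have "(LINT \<omega>|lborel. (LINT t|lborel. \<phi> t * cis (- (2 * pi * (\<omega> \<bullet> t)))) * gaussian (\<omega> - \<eta>))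
    = (LINT \<omega>|lborel. (LINT t|lborel. gaussian (\<omega> - \<eta>) * \<phi> t * cis (- (2 * pi * (\<omega> \<bullet> t)))))"
    by (simp only: mult.assoc integral_mult_right_zero mult.commute[of _ "gaussian _"])
  also have "\<dots> = (LINT t|lborel. (LINT \<omega>|lborel. gaussian (\<omega> - \<eta>) * \<phi> t * cis (- (2 * pi * (\<omega> \<bullet> t)))))"
    by (rule lborel_pair.Fubini_integral[symmetric]) (use int in simp)
  also have "\<dots> = (LINT t|lborel. \<phi> t * (LINT \<omega>|lborel. gaussian (\<omega> - \<eta>) * cis (- (2 * pi * (\<omega> \<bullet> t)))))"
    by (simp only: mult.assoc mult.left_commute[of _ "\<phi> _"] integral_mult_right_zero)
  finally show ?thesis by (simp add: inner)
qed

text \<open>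
  The multiplication formula survives the \<open>L^2\<close> limit and gives, for each \<open>\<eta>\<close>, the Fourier integral of
  \<open>g \<cdot> gaussian\<close> at \<open>\<eta>\<close> in terms of \<open>G\<close>.  The bounded function defined by the inverse Fourier
  integral of \<open>G\<close> has the same property by Fubini.  Both products with the Gaussian are integrable, so the two
  functions agree almost everywhere by uniqueness of Fourier integrals.
\<close>

lemma fourier_inversion_compact:
  fixes g G :: "real ^ 'd::finite \<Rightarrow> complex"
  assumes FT: "fourier_L2 g G" and supp: "ess_support G \<subseteq> K'" and K': "compact K'"
  obtains G' where "G' \<in> borel_measurable borel" "integrable lborel G'" "\<And>\<omega>. \<omega> \<notin> K' \<Longrightarrow> G' \<omega> = 0"
    "integrable lborel (\<lambda>\<omega>. (norm (G' \<omega>))\<^sup>2)"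
    "AE t in lborel. g t = (LINT \<omega>|lborel. G' \<omega> * cis (2 * pi * (\<omega> \<bullet> t)))"
proof -
  obtain \<phi> where sq: "square_integrable g" "square_integrable G" "\<And>n. square_integrable (\<phi> n)"
    and \<phi>: "\<And>n. integrable lebesgue (\<phi> n)"
    and lim1: "(\<lambda>n. \<integral>\<^sup>+ t. ennreal ((norm (\<phi> n t - g t))\<^sup>2) \<partial>lebesgue) \<longlonglongrightarrow> 0"
    and lim2: "(\<lambda>n. \<integral>\<^sup>+ \<omega>. ennreal ((norm (fourier_integral (\<phi> n) \<omega> - G \<omega>))\<^sup>2) \<partial>lebesgue) \<longlonglongrightarrow> 0"
    using FT unfolding fourier_L2_def by blast
  obtain G' where G'[measurable]: "G' \<in> borel_measurable borel" and GG': "AE x in lborel. G x = G' x"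
    and G'sq: "integrable lborel (\<lambda>x. (norm (G' x))\<^sup>2)" and G'int: "integrable lborel G'"
    and G'0: "\<And>x. x \<notin> K' \<Longrightarrow> G' x = 0"
    using L2_on_ex_borel[OF sq(2) supp K'] by blast
  obtain g' where g'[measurable]: "g' \<in> borel_measurable borel" and gg': "AE x in lborel. g x = g' x"
    and g'sq: "integrable lborel (\<lambda>x. (norm (g' x))\<^sup>2)"
    using square_integrable_ex_borel[OF sq(1)] by blast
  have "\<forall>n. \<exists>p. p \<in> borel_measurable borel \<and> (AE x in lborel. \<phi> n x = p x) \<and> integrable lborel (\<lambda>x. (norm (p x))\<^sup>2)"
    using square_integrable_ex_borel[OF sq(3)] by blast
  from choice[OF this] obtain p where p[measurable]: "\<And>n. p n \<in> borel_measurable borel" and \<phi>p: "\<And>n. AE x in lborel. \<phi> n x = p n x"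
    and psq: "\<And>n. integrable lborel (\<lambda>x. (norm (p n x))\<^sup>2)" by blast
  have pint: "integrable lborel (p n)" for n
  proof -
    have "integrable lebesgue (p n)"
      using \<phi>p by (intro integrable_cong_AE_imp[OF \<phi>]) (auto simp: AE_completion_iff measurable_completion)
    then show ?thesis by (subst (asm) integrable_completion) auto
  qed
  have Fp: "fourier_integral (\<phi> n) = (\<lambda>\<omega>. LINT t|lborel. p n t * cis (- (2 * pi * (\<omega> \<bullet> t))))" for n
  proof
    fix \<omega>
    have "AE t in lborel. \<phi> n t * cis (- (2 * pi * (\<omega> \<bullet> t))) = p n t * cis (- (2 * pi * (\<omega> \<bullet> t)))"
      using \<phi>p[of n] by eventually_elim simp
    then show "fourier_integral (\<phi> n) \<omega> = (LINT t|lborel. p n t * cis (- (2 * pi * (\<omega> \<bullet> t))))"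
      unfolding fourier_integral_def by (intro lebesgue_integral_cong_lborel) simp_all
  qed
  define q where "q n \<omega> = (LINT t|lborel. p n t * cis (- (2 * pi * (\<omega> \<bullet> t))))" for n \<omega>
  have [measurable]: "q n \<in> borel_measurable borel" for n unfolding q_def by measurable
  have L1: "(\<lambda>n. \<integral>\<^sup>+ t. ennreal ((norm (p n t - g' t))\<^sup>2) \<partial>lborel) \<longlonglongrightarrow> 0"
  proof -
    have "(\<integral>\<^sup>+ t. ennreal ((norm (\<phi> n t - g t))\<^sup>2) \<partial>lebesgue) = (\<integral>\<^sup>+ t. ennreal ((norm (p n t - g' t))\<^sup>2) \<partial>lborel)" for n
      unfolding nn_integral_completion
    proof (rule nn_integral_cong_AE)
      show "AE t in lborel. ennreal ((norm (\<phi> n t - g t))\<^sup>2) = ennreal ((norm (p n t - g' t))\<^sup>2)"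
        using \<phi>p[of n] gg' by eventually_elim simp
    qed
    with lim1 show ?thesis by simp
  qed
  have L2: "(\<lambda>n. \<integral>\<^sup>+ t. ennreal ((norm (q n t - G' t))\<^sup>2) \<partial>lborel) \<longlonglongrightarrow> 0"
  proof -
    have "(\<integral>\<^sup>+ t. ennreal ((norm (fourier_integral (\<phi> n) t - G t))\<^sup>2) \<partial>lebesgue) = (\<integral>\<^sup>+ t. ennreal ((norm (q n t - G' t))\<^sup>2) \<partial>lborel)" for n
      unfolding nn_integral_completion Fp q_def[symmetric]
    proof (rule nn_integral_cong_AE)
      show "AE t in lborel. ennreal ((norm (q n t - G t))\<^sup>2) = ennreal ((norm (q n t - G' t))\<^sup>2)"
        using GG' by eventually_elim simp
    qed
    with lim2 show ?thesis by simp
  qed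
  have gsq: "integrable lborel (\<lambda>x::real^'d. (norm (gaussian x))\<^sup>2)"
    by (rule Bochner_Integration.integrable_bound[OF integrable_gaussian])
       (auto simp: gaussian_def norm_power power2_eq_square intro!: mult_left_le AE_I2)
  have gsq': "integrable lborel (\<lambda>x::real^'d. (norm (gaussian (x - \<eta>)))\<^sup>2)" for \<eta>
    using integrable_translate[of "\<lambda>x. of_real ((norm (gaussian x))\<^sup>2)" \<eta>] gsq
    by (simp only: complex_of_real_integrable_eq)
  have weak: "(LINT \<omega>|lborel. G' \<omega> * gaussian (\<omega> - \<eta>)) = (LINT t|lborel. g' t * (gaussian t * cis (- (2 * pi * (\<eta> \<bullet> t)))))" for \<eta>
  proof (rule LIMSEQ_unique)
    show "(\<lambda>n. LINT t|lborel. p n t * (gaussian t * cis (- (2 * pi * (\<eta> \<bullet> t))))) \<longlonglongrightarrow> (LINT t|lborel. g' t * (gaussian t * cis (- (2 * pi * (\<eta> \<bullet> t)))))"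
    proof (rule tendsto_integral_mult_L2[OF _ _ _ _ _ _ L1])
      show v: "integrable lborel (\<lambda>x. (norm (gaussian x * cis (- (2 * pi * (\<eta> \<bullet> x)))))\<^sup>2)"
        using gsq by (simp add: norm_mult)
      show "integrable lborel (\<lambda>x. g' x * (gaussian x * cis (- (2 * pi * (\<eta> \<bullet> x)))))"
        by (rule integrable_mult_L2) (use v g'sq in auto)
      show "integrable lborel (\<lambda>x. p n x * (gaussian x * cis (- (2 * pi * (\<eta> \<bullet> x)))))" for n
        by (rule integrable_mult_L2) (use v psq in auto)
    qed measurable
    have "(\<lambda>n. LINT \<omega>|lborel. q n \<omega> * gaussian (\<omega> - \<eta>)) \<longlonglongrightarrow> (LINT \<omega>|lborel. G' \<omega> * gaussian (\<omega> - \<eta>))"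
    proof (rule tendsto_integral_mult_L2[OF _ _ _ gsq' _ _ L2])
      show "integrable lborel (\<lambda>x. G' x * gaussian (x - \<eta>))"
        by (rule integrable_mult_L2) (use gsq' G'sq in auto)
      fix n
      have bd: "norm (q n \<omega>) \<le> (LINT t|lborel. norm (p n t))" for \<omega>
        unfolding q_def using integral_norm_bound[of lborel "\<lambda>t. p n t * cis (- (2 * pi * (\<omega> \<bullet> t)))"] by (simp add: norm_mult)
      show "integrable lborel (\<lambda>x. q n x * gaussian (x - \<eta>))"
      proof (rule Bochner_Integration.integrable_bound)
        show "integrable lborel (\<lambda>x. (LINT t|lborel. norm (p n t)) * gaussian (x - \<eta>))"
          by (intro integrable_mult_right integrable_translate[OF integrable_gaussian])
        show "AE x in lborel. norm (q n x * gaussian (x - \<eta>)) \<le> norm ((LINT t|lborel. norm (p n t)) * gaussian (x - \<eta>))"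
          using bd by (intro AE_I2) (simp add: norm_mult mult_right_mono)
      qed measurable
    qed measurable
    then show "(\<lambda>n. LINT t|lborel. p n t * (gaussian t * cis (- (2 * pi * (\<eta> \<bullet> t))))) \<longlonglongrightarrow> (LINT \<omega>|lborel. G' \<omega> * gaussian (\<omega> - \<eta>))"
      unfolding q_def multiplication_formula_gaussian[OF pint] .
  qed
  define g2 where "g2 t = (LINT \<omega>|lborel. G' \<omega> * cis (2 * pi * (\<omega> \<bullet> t)))" for t
  have [measurable]: "g2 \<in> borel_measurable borel" unfolding g2_def by measurable
  have bd2: "norm (g2 t) \<le> (LINT \<omega>|lborel. norm (G' \<omega>))" for t
    unfolding g2_def using integral_norm_bound[of lborel "\<lambda>\<omega>. G' \<omega> * cis (2 * pi * (\<omega> \<bullet> t))"] by (simp add: norm_mult)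
  have g2i: "integrable lborel (\<lambda>t. g2 t * gaussian t)"
  proof (rule Bochner_Integration.integrable_bound)
    show "integrable lborel (\<lambda>x::real^'d. (LINT \<omega>|lborel. norm (G' \<omega>)) * gaussian x)"
      by (intro integrable_mult_right integrable_gaussian)
    show "AE x in lborel. norm (g2 x * gaussian x) \<le> norm ((LINT \<omega>|lborel. norm (G' \<omega>)) * gaussian x)"
      using bd2 by (intro AE_I2) (simp add: norm_mult mult_right_mono)
  qed measurable
  have g1i: "integrable lborel (\<lambda>t. g' t * gaussian t)" 
    by (rule integrable_mult_L2) (use gsq g'sq in auto)
  have g2: "(LINT t|lborel. g2 t * gaussian t * cis (2 * pi * (\<eta> \<bullet> t))) = (LINT \<omega>|lborel. G' \<omega> * gaussian (\<omega> + \<eta>))" for \<eta>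
  proof -
    have int: "integrable (lborel \<Otimes>\<^sub>M lborel) (\<lambda>(\<omega>, t). G' \<omega> * gaussian t * cis (2 * pi * ((\<omega> + \<eta>) \<bullet> t)))"
      using integrable_times_cis[OF integrable_tensor[OF G'int integrable_gaussian], of "\<lambda>(\<omega>, t). 2 * pi * ((\<omega> + \<eta>) \<bullet> t)"]
      by (simp add: case_prod_unfold)
    have "g2 t * gaussian t * cis (2 * pi * (\<eta> \<bullet> t)) = (LINT \<omega>|lborel. G' \<omega> * gaussian t * cis (2 * pi * ((\<omega> + \<eta>) \<bullet> t)))" for t
    proof -
      have "G' \<omega> * gaussian t * cis (2 * pi * ((\<omega> + \<eta>) \<bullet> t)) = (G' \<omega> * cis (2 * pi * (\<omega> \<bullet> t))) * (gaussian t * cis (2 * pi * (\<eta> \<bullet> t)))" for \<omega>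
        by (simp add: inner_add_left distrib_left flip: cis_mult)
      then have "(LINT \<omega>|lborel. G' \<omega> * gaussian t * cis (2 * pi * ((\<omega> + \<eta>) \<bullet> t))) = g2 t * (gaussian t * cis (2 * pi * (\<eta> \<bullet> t)))"
        unfolding g2_def by (simp only: integral_mult_left_zero)
      then show ?thesis by (simp only: mult.assoc)
    qed
    then have "(LINT t|lborel. g2 t * gaussian t * cis (2 * pi * (\<eta> \<bullet> t)))
      = (LINT t|lborel. (LINT \<omega>|lborel. G' \<omega> * gaussian t * cis (2 * pi * ((\<omega> + \<eta>) \<bullet> t))))" by simp
    also have "\<dots> = (LINT \<omega>|lborel. (LINT t|lborel. G' \<omega> * gaussian t * cis (2 * pi * ((\<omega> + \<eta>) \<bullet> t))))"
      by (rule lborel_pair.Fubini_integral) (use int in simp)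
    also have "\<dots> = (LINT \<omega>|lborel. G' \<omega> * (LINT t|lborel. gaussian t * cis (2 * pi * ((\<omega> + \<eta>) \<bullet> t))))"
      by (simp only: mult.assoc integral_mult_right_zero)
    finally show ?thesis by (simp only: integral_gaussian_cis)
  qed
  have "AE t in lborel. g' t * gaussian t - g2 t * gaussian t = 0"
  proof (rule fourier_uniqueness_L1)
    fix \<eta>
    have "(LINT t|lborel. g' t * gaussian t * cis (2 * pi * (\<eta> \<bullet> t))) = (LINT \<omega>|lborel. G' \<omega> * gaussian (\<omega> + \<eta>))"
      using weak[of "-\<eta>"] by (simp add: mult.assoc)
    with g2[of \<eta>] show "(LINT t|lborel. (g' t * gaussian t - g2 t * gaussian t) * cis (2 * pi * (\<eta> \<bullet> t))) = 0"
      by (simp add: left_diff_distrib integrable_times_cis[OF g1i] integrable_times_cis[OF g2i])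
  qed (use g1i g2i in simp)
  then have "AE t in lborel. g t = g2 t"
    using gg' by eventually_elim (auto simp: gaussian_def)
  then show ?thesis
    using that[OF G' G'int G'0 G'sq] unfolding g2_def by blast
qed

section \<open>Sampling on a lattice determines the autocorrelation\<close>

definition join_vec :: "(real ^ 'd::finite) \<times> (real ^ 'd) \<Rightarrow> real ^ ('d + 'd)" where
  "join_vec p = (\<chi> i. case i of Inl j \<Rightarrow> fst p $ j | Inr j \<Rightarrow> snd p $ j)"

lemma split_join [simp]: "split_vec (join_vec p) = p"
  by (simp add: split_vec_def join_vec_def prod_eq_iff vec_eq_iff)

lemma linear_split_vec: "linear split_vec"
  by (rule linearI) (simp_all add: split_vec_def vec_eq_iff)

lemma linear_join_vec: "linear join_vec"
  by (rule linearI) (simp_all add: join_vec_def vec_eq_iff split: sum.split)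

lemma sum_UNIV_Plus: "(\<Sum>i\<in>UNIV. f i) = (\<Sum>j\<in>UNIV. f (Inl j)) + (\<Sum>j\<in>UNIV. f (Inr j))"
  for f :: "'a::finite + 'b::finite \<Rightarrow> real"
  unfolding UNIV_Plus_UNIV[symmetric] by (subst sum.Plus) simp_all

lemma inner_split_vec: "split_vec v \<bullet> p = v \<bullet> join_vec p"
  by (simp add: split_vec_def join_vec_def inner_prod_def inner_vec_def sum_UNIV_Plus)

lemma borel_measurable_if_linear:
  fixes f :: "'a::euclidean_space \<Rightarrow> 'b::euclidean_space"
  assumes "linear f" shows "f \<in> borel_measurable borel"
  using linear_continuous_on[of f UNIV] assms
  by (intro borel_measurable_continuous_onI) (simp add: linear_conv_bounded_linear)

lemma AE_pair_difference:
  fixes P :: "'a::euclidean_space \<Rightarrow> bool"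
  assumes "AE w in lborel. P w"
  shows "AE (q, p) in lborel \<Otimes>\<^sub>M lborel. P (p - q)"
proof -
  obtain N where N: "{w. \<not> P w} \<subseteq> N" "N \<in> null_sets lborel"
    using assms by (auto simp: eventually_ae_filter)
  then have [measurable]: "N \<in> sets borel" by auto
  have "AE w in lborel. w \<notin> N" using N(2) by (rule AE_not_in)
  then have "AE p in lborel. p - q \<notin> N" for q
    by (subst (asm) lborel_translate_minus[of q, symmetric]) (subst (asm) AE_distr_iff, auto)
  then have "AE x in lborel \<Otimes>\<^sub>M lborel. snd x - fst x \<notin> N"
  proof (intro lborel_pair.AE_pair_measure)
    show "{x \<in> space (lborel \<Otimes>\<^sub>M lborel). snd x - fst x \<notin> N} \<in> sets (lborel \<Otimes>\<^sub>M lborel)"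
      by measurable
  qed simp
  then show ?thesis using N(1) by (auto elim!: eventually_mono)
qed

lemma integrable_shear:
  fixes H :: "'a::euclidean_space \<times> 'a \<Rightarrow> complex"
  assumes H: "integrable (lborel \<Otimes>\<^sub>M lborel) H"
  shows "integrable (lborel \<Otimes>\<^sub>M lborel) (\<lambda>(q, w). H (q, q + w))"
    and "integral\<^sup>L (lborel \<Otimes>\<^sub>M lborel) (\<lambda>(q, w). H (q, q + w)) = integral\<^sup>L (lborel \<Otimes>\<^sub>M lborel) H"
proof -
  have [measurable]: "H \<in> borel_measurable (borel \<Otimes>\<^sub>M borel)"
    using borel_measurable_integrable[OF H] by (simp cong: measurable_cong_sets)
  have m: "(\<lambda>w. H (q, w)) \<in> borel_measurable borel" for q by measurable
  have tr: "(LINT w|lborel. f (q + w)) = (LINT w|lborel. f w)" if "f \<in> borel_measurable borel" for f :: "'a \<Rightarrow> complex" and q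
    using integral_translate[OF that, of "-q"] by (simp add: add.commute)
  show *: "integrable (lborel \<Otimes>\<^sub>M lborel) (\<lambda>(q, w). H (q, q + w))"
  proof (rule lborel_pair.Fubini_integrable)
    have "(LINT w|lborel. norm (H (q, q + w))) = (LINT w|lborel. norm (H (q, w)))" for q
      using tr[of "\<lambda>w. of_real (norm (H (q, w)))" q] by (simp add: m)
    moreover have "integrable lborel (\<lambda>q. LINT w|lborel. norm (H (q, w)))"
      by (rule lborel_pair.integrable_fst') (use H in simp)
    ultimately show "integrable lborel (\<lambda>x. LINT y|lborel. norm (case (x, y) of (q, w) \<Rightarrow> H (q, q + w)))"
      by simp
    show "AE q in lborel. integrable lborel (\<lambda>w. case (q, w) of (q, w) \<Rightarrow> H (q, q + w))"
      using lborel_pair.AE_integrable_fst'[OF H]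
    proof eventually_elim
      case (elim q)
      from integrable_translate[OF this, of "-q"] show ?case by (simp add: add.commute)
    qed
  qed measurable
  show "integral\<^sup>L (lborel \<Otimes>\<^sub>M lborel) (\<lambda>(q, w). H (q, q + w)) = integral\<^sup>L (lborel \<Otimes>\<^sub>M lborel) H"
  proof -
    have "(LINT w|lborel. H (q, q + w)) = (LINT w|lborel. H (q, w))" for q by (rule tr[OF m])
    then show ?thesis using lborel_pair.integral_fst'[OF *] lborel_pair.integral_fst'[OF H] by simp
  qed
qed

definition autocorrelation :: "('a::euclidean_space \<Rightarrow> complex) \<Rightarrow> 'a \<Rightarrow> complex" where
  "autocorrelation F w = (LINT q|lborel. F (q + w) * cnj (F q))"

text \<open>
  The squared modulus at \<open>z\<close> of the Fourier integral of \<open>F\<close> is the double integral of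
  \<open>F p * cnj (F q) * cis (2 * pi * (z \<bullet> (p - q)))\<close>.  In the coordinates of the lattice generated by \<open>M\<close>,
  the vector \<open>p - q\<close> becomes \<open>w = M\<^sup>T (p - q)\<close>, points of \<open>U\<close> become integer characters of \<open>w\<close>, and
  the dual lattice becomes the lattice of integer points.  So the difference of the two double integrands is
  orthogonal to every periodic set of \<open>w\<close>.  The periodization of a set \<open>A \<subseteq> T\<close> coincides, for \<open>p\<close> and \<open>q\<close> in
  \<open>S\<close>, with \<open>A\<close> itself up to a null set, because \<open>T\<close> lies in a fundamental domain.
\<close>

lemma autocorrelation_determined_by_lattice:
  fixes F1 F2 :: "(real ^ 'd::finite) \<times> (real ^ 'd) \<Rightarrow> complex"
  assumes F1: "integrable lborel F1" and F2: "integrable lborel F2"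
    and supp: "\<And>p. p \<notin> S \<Longrightarrow> F1 p = 0" "\<And>p. p \<notin> S \<Longrightarrow> F2 p = 0"
    and T[measurable]: "T \<in> sets borel" and TD: "T \<subseteq> D" and ST: "\<And>p q. p \<in> S \<Longrightarrow> q \<in> S \<Longrightarrow> p - q \<in> T"
    and D: "fundamental_domain L D" and UL: "lattice_with_dual U L"
    and eq: "\<And>z. z \<in> U \<Longrightarrow> norm (LINT p|lborel. F1 p * cis (2 * pi * (z \<bullet> p))) = norm (LINT p|lborel. F2 p * cis (2 * pi * (z \<bullet> p)))"
  shows "AE w in lborel. autocorrelation F1 w = autocorrelation F2 w"
proof -
  note [measurable] = borel_measurable_integrable[OF F1] borel_measurable_integrable[OF F2]
  obtain M where M: "invertible M" "U = matrix_lattice M" "L = matrix_lattice (transpose (matrix_inv M))"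
    using UL unfolding lattice_with_dual_def by blast
  define J where "J = transpose (matrix_inv M)"
  have JM: "J *v (transpose M *v v) = v" for v
  proof -
    have "M ** matrix_inv M = mat 1"
      using M(1) unfolding invertible_def matrix_inv_def by (rule someI2_ex) simp
    then show ?thesis
      by (simp only: J_def matrix_vector_mul_assoc matrix_transpose_mul[symmetric] transpose_mat matrix_vector_mul_lid)
  qed
  have L0: "0 \<in> L" unfolding M matrix_lattice_def
    using int_points_0 by (auto intro!: image_eqI[where x=0] simp: split_vec_def prod_eq_iff vec_eq_iff zero_prod_def)
  have cL: "countable L" unfolding M matrix_lattice_def by (intro countable_image countable_int_points)
  define H where "H F = (\<lambda>(q, p). F p * cnj (F q))" for F :: "(real ^ 'd::finite) \<times> (real ^ 'd) \<Rightarrow> complex"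
  have HI: "integrable (lborel \<Otimes>\<^sub>M lborel) (H F)" if F: "integrable lborel F" for F
    using integrable_tensor[OF integrable_cnj[OF F] F] by (simp add: H_def mult.commute)
  define w where "w = (\<lambda>(q, p). transpose M *v join_vec (p - q))"
  have lin: "linear (\<lambda>p. transpose M *v join_vec p)"
    using linear_compose[OF linear_join_vec matrix_vector_mul_linear[of "transpose M"]] by (simp add: o_def)
  have [measurable]: "(\<lambda>p. transpose M *v join_vec p) \<in> borel_measurable borel"
    by (rule borel_measurable_if_linear[OF lin])
  have w[measurable]: "w \<in> borel_measurable (lborel \<Otimes>\<^sub>M lborel)"
    unfolding w_def by measurable
  have kw: "k \<bullet> w x = split_vec (M *v k) \<bullet> (snd x - fst x)" for k x
  proof -
    have "k \<bullet> (transpose M *v v) = (M *v k) \<bullet> v" for v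
      by (metis dot_lmul_matrix inner_commute transpose_matrix_vector)
    then show ?thesis by (simp only: w_def case_prod_unfold inner_split_vec)
  qed
  have intH: "(LINT x|(lborel \<Otimes>\<^sub>M lborel). H F x * cis (2 * pi * (z \<bullet> (snd x - fst x)))) = of_real ((norm (LINT p|lborel. F p * cis (2 * pi * (z \<bullet> p))))\<^sup>2)"
    if F: "integrable lborel F" for F z
  proof -
    note [measurable] = borel_measurable_integrable[OF F]
    define f where "f p = F p * cis (2 * pi * (z \<bullet> p))" for p
    have f: "integrable lborel f" unfolding f_def by (rule integrable_times_cis[OF F]) measurable
    have eq: "H F x * cis (2 * pi * (z \<bullet> (snd x - fst x))) = (case x of (q, p) \<Rightarrow> cnj (f q) * f p)" for x
      by (simp add: H_def f_def case_prod_unfold inner_diff_right right_diff_distrib cis_divide[symmetric] cis_cnj divide_conv_cnj)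
    have "(LINT x|(lborel \<Otimes>\<^sub>M lborel). (case x of (q, p) \<Rightarrow> cnj (f q) * f p)) = (LINT q|lborel. (LINT p|lborel. cnj (f q) * f p))"
      using lborel_pair.integral_fst'[OF integrable_tensor[OF integrable_cnj[OF f] f]] by simp
    also have "\<dots> = cnj (integral\<^sup>L lborel f) * integral\<^sup>L lborel f"
      by simp
    finally have *: "(LINT x|(lborel \<Otimes>\<^sub>M lborel). (case x of (q, p) \<Rightarrow> cnj (f q) * f p)) = cnj (integral\<^sup>L lborel f) * integral\<^sup>L lborel f" .
    have I: "(LINT p|lborel. F p * cis (2 * pi * (z \<bullet> p))) = integral\<^sup>L lborel f" unfolding f_def ..
    show ?thesis unfolding eq * I complex_norm_square by (rule mult.commute)
  qed
  define G where "G x = H F1 x - H F2 x" for x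
  have GI: "integrable (lborel \<Otimes>\<^sub>M lborel) G" unfolding G_def using HI F1 F2 by simp
  note [measurable] = borel_measurable_integrable[OF GI]
  have G0: "(LINT x|(lborel \<Otimes>\<^sub>M lborel). G x * cis (2 * pi * (k \<bullet> w x))) = 0" if k: "k \<in> int_points" for k
  proof -
    have z: "split_vec (M *v k) \<in> U" using k unfolding M matrix_lattice_def by blast
    have i: "integrable (lborel \<Otimes>\<^sub>M lborel) (\<lambda>x. H F x * cis (2 * pi * (k \<bullet> w x)))" if "integrable lborel F" for F
      by (rule integrable_times_cis[OF HI[OF that]]) measurable
    have "(LINT x|(lborel \<Otimes>\<^sub>M lborel). G x * cis (2 * pi * (k \<bullet> w x))) = 
      (LINT x|(lborel \<Otimes>\<^sub>M lborel). H F1 x * cis (2 * pi * (k \<bullet> w x))) - (LINT x|(lborel \<Otimes>\<^sub>M lborel). H F2 x * cis (2 * pi * (k \<bullet> w x)))"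
      unfolding G_def left_diff_distrib by (rule Bochner_Integration.integral_diff[OF i[OF F1] i[OF F2]])
    also have "\<dots> = 0" unfolding kw intH[OF F1] intH[OF F2] eq[OF z] by simp
    finally show ?thesis .
  qed
  \<comment> \<open>almost no point lies both in \<open>D\<close> and in another translate of \<open>D\<close>\<close>
  have null: "AE v in lborel. \<forall>l\<in>L. l \<noteq> 0 \<longrightarrow> \<not> (v \<in> D \<and> v - l \<in> D)"
  proof (subst AE_ball_countable[OF cL], intro ballI)
    fix l assume l: "l \<in> L"
    show "AE v in lborel. l \<noteq> 0 \<longrightarrow> \<not> (v \<in> D \<and> v - l \<in> D)"
    proof (cases "l = 0")
      case False
      have "\<forall>l\<in>L. \<forall>l'\<in>L. l \<noteq> l' \<longrightarrow> ((+) l ` D) \<inter> ((+) l' ` D) \<in> null_sets lebesgue"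
        using D unfolding fundamental_domain_def by (elim conjE)
      from this[rule_format, OF L0 l] False
      have "((+) 0 ` D) \<inter> ((+) l ` D) \<in> null_sets lebesgue" by simp
      then have "AE v in lebesgue. v \<notin> ((+) 0 ` D) \<inter> ((+) l ` D)" by (rule AE_not_in)
      then show ?thesis unfolding AE_completion_iff
      proof eventually_elim
        case (elim v)
        show ?case
        proof (intro impI notI)
          assume "v \<in> D \<and> v - l \<in> D"
          then have "0 + v \<in> (+) 0 ` D" "l + (v - l) \<in> (+) l ` D" by blast+
          with elim show False by simp
        qed
      qed
    qed simp
  qed
  have key: "(LINT x|(lborel \<Otimes>\<^sub>M lborel). of_real (indicator A (snd x - fst x)) * G x) = 0" if A[measurable]: "A \<in> sets borel" for A
  proof -
    \<comment> \<open>the periodization of \<open>A \<inter> T\<close> in the coordinates of \<open>w\<close>\<close>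
    define B where "B = (\<Union>k\<in>int_points. (\<lambda>v. split_vec (J *v (v - k))) -` (A \<inter> T))"
    have Bm: "B \<in> sets borel" unfolding B_def
    proof (rule sets.countable_UN''[OF countable_int_points])
      fix k
      have "linear (\<lambda>v. split_vec (J *v v))"
        using linear_compose[OF matrix_vector_mul_linear[of J] linear_split_vec] by (simp add: o_def)
      note [measurable] = borel_measurable_if_linear[OF this]
      have "(\<lambda>v. split_vec (J *v (v - k))) \<in> borel_measurable borel" by measurable
      then show "(\<lambda>v. split_vec (J *v (v - k))) -` (A \<inter> T) \<in> sets borel"
        by (rule measurable_sets_borel) simp
    qed
    have per: "v + k \<in> B \<longleftrightarrow> v \<in> B" if k: "k \<in> int_points" for v k
    proof
      assume "v + k \<in> B"
      then obtain l where l: "l \<in> int_points" "split_vec (J *v (v + k - l)) \<in> A \<inter> T" unfolding B_def by blast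
      have "v + k - l = v - (l - k)" by simp
      with l(2) have "v \<in> (\<lambda>v. split_vec (J *v (v - (l - k)))) -` (A \<inter> T)" by (simp only: vimage_eq)
      then show "v \<in> B" unfolding B_def by (rule UN_I[OF int_points_diff[OF l(1) k]])
    next
      assume "v \<in> B"
      then obtain l where l: "l \<in> int_points" "split_vec (J *v (v - l)) \<in> A \<inter> T" unfolding B_def by blast
      have "v - l = v + k - (l + k)" by simp
      with l(2) have "v + k \<in> (\<lambda>v. split_vec (J *v (v - (l + k)))) -` (A \<inter> T)" by (simp only: vimage_eq)
      then show "v + k \<in> B" unfolding B_def by (rule UN_I[OF int_points_add[OF l(1) k]])
    qed
    have wB: "w x \<in> B \<longleftrightarrow> (\<exists>l\<in>L. snd x - fst x - l \<in> A \<inter> T)" for x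
    proof -
      have "split_vec (J *v (w x - k)) = snd x - fst x - split_vec (J *v k)" for k
        by (simp add: w_def case_prod_unfold matrix_vector_mult_diff_distrib JM linear_diff[OF linear_split_vec] del: transpose_matrix_vector)
      then show ?thesis by (simp add: B_def M(3) matrix_lattice_def J_def)
    qed
    have "(LINT x|(lborel \<Otimes>\<^sub>M lborel). of_real (indicator A (snd x - fst x)) * G x) = (LINT x|(lborel \<Otimes>\<^sub>M lborel). of_real (indicator B (w x)) * G x)"
    proof (rule integral_cong_AE)
      show "(\<lambda>x. of_real (indicator A (snd x - fst x)) * G x) \<in> borel_measurable (lborel \<Otimes>\<^sub>M lborel)" by measurable
      show "(\<lambda>x. of_real (indicator B (w x)) * G x) \<in> borel_measurable (lborel \<Otimes>\<^sub>M lborel)" using Bm by measurable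
      show "AE x in lborel \<Otimes>\<^sub>M lborel. of_real (indicator A (snd x - fst x)) * G x = of_real (indicator B (w x)) * G x"
        using AE_pair_difference[OF null]
      proof eventually_elim
        case (elim x)
        show ?case
        proof (cases "fst x \<in> S \<and> snd x \<in> S")
          case True
          then have T: "snd x - fst x \<in> T" using ST by blast
          have "w x \<in> B \<longleftrightarrow> snd x - fst x \<in> A"
          proof
            assume "w x \<in> B"
            then obtain l where l: "l \<in> L" "snd x - fst x - l \<in> A \<inter> T" by (auto simp: wB)
            then have "l = 0" using elim T TD by (cases x) auto
            then show "snd x - fst x \<in> A" using l by simp
          next
            assume "snd x - fst x \<in> A"
            then show "w x \<in> B" unfolding wB using L0 T by (intro bexI[of _ 0]) auto
          qed
          then show ?thesis by (simp add: indicator_def)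
        next
          case False
          then have "G x = 0" using supp by (cases x) (auto simp: G_def H_def)
          then show ?thesis by simp
        qed
      qed
    qed
    also have "\<dots> = 0" by (rule integer_characters_determine[OF GI w G0 Bm per])
    finally show ?thesis .
  qed
  have sh: "integrable (lborel \<Otimes>\<^sub>M lborel) (\<lambda>(q, v). G (q, q + v))" by (rule integrable_shear(1)[OF GI])
  \<comment> \<open>\<open>R\<close> is the difference of the two autocorrelations\<close>
  define R where "R v = (LINT q|lborel. G (q, q + v))" for v
  have "AE v in lborel. R v = 0"
  proof (rule sigma_finite_measure.density_zero[OF sigma_finite_lborel])
    show "integrable lborel R" unfolding R_def using lborel_pair.integrable_snd[OF sh] by simp
    fix A :: "((real ^ 'd) \<times> (real ^ 'd)) set" assume "A \<in> sets lborel"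
    then have A[measurable]: "A \<in> sets borel" by simp
    define GA where "GA x = of_real (indicator A (snd x - fst x)) * G x" for x
    have [measurable]: "GA \<in> borel_measurable (lborel \<Otimes>\<^sub>M lborel)" unfolding GA_def by measurable
    have GAI: "integrable (lborel \<Otimes>\<^sub>M lborel) GA"
      by (rule Bochner_Integration.integrable_bound[OF GI])
         (auto simp: GA_def norm_mult intro!: AE_I2 mult_left_le_one_le)
    have "(LINT v:A|lborel. R v) = (LINT v|lborel. (LINT q|lborel. GA (q, q + v)))"
      unfolding set_lebesgue_integral_def R_def GA_def by (simp add: scaleR_conv_of_real)
    also have "\<dots> = integral\<^sup>L (lborel \<Otimes>\<^sub>M lborel) (\<lambda>(q, v). GA (q, q + v))"
      by (rule lborel_pair.integral_snd[OF integrable_shear(1)[OF GAI]])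
    also have "\<dots> = integral\<^sup>L (lborel \<Otimes>\<^sub>M lborel) GA" by (rule integrable_shear(2)[OF GAI])
    also have "\<dots> = 0" unfolding GA_def by (rule key[OF A])
    finally show "(LINT v:A|lborel. R v) = 0" .
  qed
  moreover have "AE v in lborel. integrable lborel (\<lambda>q. F1 (q + v) * cnj (F1 q))"
    using lborel_pair.AE_integrable_snd[OF integrable_shear(1)[OF HI[OF F1]]] by (simp add: H_def)
  moreover have "AE v in lborel. integrable lborel (\<lambda>q. F2 (q + v) * cnj (F2 q))"
    using lborel_pair.AE_integrable_snd[OF integrable_shear(1)[OF HI[OF F2]]] by (simp add: H_def)
  ultimately show ?thesis
    by eventually_elim (simp add: R_def G_def H_def autocorrelation_def)
qed

section \<open>From the autocorrelation to the signal\<close>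

lemma ex_neq_0_if_AE:
  assumes "\<not> (AE x in M. f x = 0)" "AE x in M. Q x"
  obtains x where "f x \<noteq> 0" "Q x"
  using assms by (metis (mono_tags, lifting) eventually_mono)

lemma AE_translate:
  fixes P :: "'a::euclidean_space \<Rightarrow> bool"
  assumes "AE s in lborel. P (t + s)" and [measurable]: "Measurable.pred borel P"
  shows "AE s in lborel. P s"
proof -
  have "AE s in distr lborel borel ((+) t). P s" using assms by (subst AE_distr_iff) auto
  then show ?thesis unfolding lborel_distr_plus .
qed

lemma lborel_uminus: "distr lborel borel uminus = (lborel :: 'a::euclidean_space measure)"
proof -
  have "lborel = density (distr lborel borel (\<lambda>x::'a. 0 + (-1) *\<^sub>R x)) (\<lambda>_. ennreal (\<bar>-1\<bar> ^ DIM('a)))"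
    by (rule lborel_affine) simp
  then show ?thesis by (simp add: density_1 one_ennreal_def[symmetric])
qed

lemma integral_reflect:
  fixes f :: "'a::euclidean_space \<Rightarrow> complex"
  assumes [measurable]: "f \<in> borel_measurable borel"
  shows "(LINT x|lborel. f (- x)) = (LINT x|lborel. f x)"
  by (subst (2) lborel_uminus[symmetric]) (simp add: integral_distr)

lemma integrable_reflect:
  fixes f :: "'a::euclidean_space \<Rightarrow> 'b::{banach, second_countable_topology}"
  assumes "integrable lborel f" shows "integrable lborel (\<lambda>x. f (- x))"
proof -
  have "integrable (distr lborel borel uminus) f" using assms by (simp add: lborel_uminus)
  then show ?thesis by (subst (asm) integrable_distr_eq) (use assms in auto)
qed

text \<open>
  By Fubini, for almost every \<open>t\<close> the functions \<open>cnj (f t) f\<close> and \<open>cnj (h t) h\<close> agree almost everywhere.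
  A point \<open>t\<close> with \<open>f t \<noteq> 0\<close> provides the factor, and comparing once more shows that it has modulus one.
\<close>

lemma eq_up_to_phase:
  fixes f h :: "'a::euclidean_space \<Rightarrow> complex"
  assumes [measurable]: "f \<in> borel_measurable borel" "h \<in> borel_measurable borel"
    and eq: "AE y in lborel. AE t in lborel. f (t + y) * cnj (f t) = h (t + y) * cnj (h t)"
  shows "\<exists>\<tau>. norm \<tau> = 1 \<and> (AE t in lborel. f t = \<tau> * h t)"
proof -
  have "AE t in lborel. AE y in lborel. f (t + y) * cnj (f t) = h (t + y) * cnj (h t)"
    using eq by (subst lborel_pair.AE_commute) measurable
  then have fh: "AE t in lborel. AE s in lborel. f s * cnj (f t) = h s * cnj (h t)"
  proof eventually_elim
    case (elim t)
    show ?case by (rule AE_translate[OF elim]) measurable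
  qed
  show ?thesis
  proof (cases "AE t in lborel. f t = 0")
    case True
    have "AE t in lborel. h t = 0"
    proof (rule ccontr)
      assume nz: "\<not> (AE t in lborel. h t = 0)"
      obtain t where "h t \<noteq> 0" "f t = 0 \<and> (AE s in lborel. f s * cnj (f t) = h s * cnj (h t))"
        by (rule ex_neq_0_if_AE[OF nz eventually_conj[OF True fh]])
      then have "AE s in lborel. h s = 0" by (auto elim!: eventually_mono)
      with nz show False ..
    qed
    with True have "AE t in lborel. f t = 1 * h t" by eventually_elim simp
    then show ?thesis by (intro exI[of _ 1]) simp
  next
    case False
    obtain t where t: "f t \<noteq> 0" "AE s in lborel. f s * cnj (f t) = h s * cnj (h t)"
      by (rule ex_neq_0_if_AE[OF False fh])
    define \<tau> where "\<tau> = cnj (h t) / cnj (f t)"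
    have \<tau>: "AE s in lborel. f s = \<tau> * h s"
      using t(2) by eventually_elim (use t(1) in \<open>simp add: \<tau>_def field_simps\<close>)
    obtain t1 where t1: "f t1 \<noteq> 0" "f t1 = \<tau> * h t1 \<and> (AE s in lborel. f s * cnj (f t1) = h s * cnj (h t1))"
      by (rule ex_neq_0_if_AE[OF False eventually_conj[OF \<tau> fh]])
    obtain s where s: "f s \<noteq> 0" "f s = \<tau> * h s \<and> f s * cnj (f t1) = h s * cnj (h t1)"
      by (rule ex_neq_0_if_AE[OF False eventually_conj[OF \<tau> conjunct2[OF t1(2)]]])
    have "(\<tau> * cnj \<tau>) * (h s * cnj (h t1)) = h s * cnj (h t1)"
      using s t1 by (metis (no_types, opaque_lifting) complex_cnj_mult mult.assoc mult.left_commute)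
    moreover have "h s * cnj (h t1) \<noteq> 0" using s t1 by auto
    ultimately have "\<tau> * cnj \<tau> = 1" by simp
    then have "complex_of_real ((norm \<tau>)\<^sup>2) = of_real 1"
      by (simp only: complex_norm_square of_real_1)
    then have "(norm \<tau>)\<^sup>2 = 1" by (simp only: of_real_eq_iff)
    then have "norm \<tau> = 1" using norm_ge_zero[of \<tau>] unfolding power2_eq_1_iff by linarith
    with \<tau> show ?thesis by blast
  qed
qed

text \<open>
  The function on phase space whose Fourier integral is the short-time Fourier transform of the reflection of \<open>a\<close>,
  for a window with Fourier transform \<open>G\<close>.
\<close>

definition phase_space_signal ::
  "('a::euclidean_space \<Rightarrow> complex) \<Rightarrow> ('a \<Rightarrow> complex) \<Rightarrow> 'a \<times> 'a \<Rightarrow> complex" where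
  "phase_space_signal G a = (\<lambda>(b, t). a t * cnj (G b) * cis (2 * pi * (b \<bullet> t)))"

lemma integrable_phase_space_signal:
  fixes a G :: "'a::euclidean_space \<Rightarrow> complex"
  assumes a: "integrable lborel a" and G: "integrable lborel G"
  shows "integrable lborel (phase_space_signal G a)"
proof -
  note [measurable] = borel_measurable_integrable[OF a] borel_measurable_integrable[OF G]
  have "integrable (lborel \<Otimes>\<^sub>M lborel) (\<lambda>x. (case x of (b, t) \<Rightarrow> cnj (G b) * a t) * cis (2 * pi * (fst x \<bullet> snd x)))"
    by (intro integrable_times_cis integrable_tensor integrable_cnj G a) measurable
  then show ?thesis by (simp add: phase_space_signal_def lborel_prod case_prod_unfold mult.commute)
qed

text \<open>
  Write the window as the inverse Fourier integral of \<open>G\<close> and substitute \<open>t \<mapsto> -t\<close>.  The reflection makes the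
  phase \<open>x \<bullet> b + \<xi> \<bullet> t\<close> the inner product of \<open>(x, \<xi>)\<close> with \<open>(b, t)\<close>.
\<close>

lemma stft_eq_fourier_phase_space_signal:
  fixes f f' g G :: "'a::euclidean_space \<Rightarrow> complex"
  assumes f': "integrable lborel f'" and ff': "AE t in lborel. f t = f' t"
    and G: "integrable lborel G" and g: "AE t in lborel. g t = (LINT \<omega>|lborel. G \<omega> * cis (2 * pi * (\<omega> \<bullet> t)))"
  shows "stft g f x \<xi> = (LINT p|lborel. phase_space_signal G (\<lambda>t. f' (- t)) p * cis (2 * pi * ((x, \<xi>) \<bullet> p)))"
proof -
  note [measurable] = borel_measurable_integrable[OF f'] borel_measurable_integrable[OF G]
  define g' where "g' t = (LINT \<omega>|lborel. G \<omega> * cis (2 * pi * (\<omega> \<bullet> t)))" for t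
  have [measurable]: "g' \<in> borel_measurable borel" unfolding g'_def by measurable
  obtain N where N: "{t. g t \<noteq> g' t} \<subseteq> N" "N \<in> null_sets lborel"
    using g unfolding g'_def[symmetric] by (auto simp: eventually_ae_filter)
  then have [measurable]: "N \<in> sets borel" by auto
  have "AE t in lborel. t - x \<notin> N"
    using AE_not_in[OF N(2)] by (subst (asm) lborel_translate_minus[of x, symmetric]) (subst (asm) AE_distr_iff, auto)
  then have gx: "AE t in lborel. g (t - x) = g' (t - x)" using N(1) by (auto elim!: eventually_mono)
  define u where "u t = f' t * cnj (g' (t - x)) * cis (- (2 * pi * (\<xi> \<bullet> t)))" for t
  have um[measurable]: "u \<in> borel_measurable borel" unfolding u_def by measurable
  have "stft g f x \<xi> = integral\<^sup>L lborel u"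
    unfolding stft_def
  proof (rule lebesgue_integral_cong_lborel[OF um])
    show "AE t in lborel. f t * cnj (g (t - x)) * cis (- (2 * pi * (\<xi> \<bullet> t))) = u t"
      using ff' gx by eventually_elim (simp add: u_def)
  qed
  also have "\<dots> = (LINT t|lborel. u (- t))" by (rule integral_reflect[OF um, symmetric])
  also have "\<dots> = (LINT t|lborel. (LINT b|lborel. phase_space_signal G (\<lambda>t. f' (- t)) (b, t) * cis (2 * pi * ((x, \<xi>) \<bullet> (b, t)))))"
  proof (rule Bochner_Integration.integral_cong[OF refl])
    fix t
    have "phase_space_signal G (\<lambda>t. f' (- t)) (b, t) * cis (2 * pi * ((x, \<xi>) \<bullet> (b, t)))
      = f' (- t) * cis (2 * pi * (\<xi> \<bullet> t)) * cnj (G b * cis (2 * pi * (b \<bullet> (- t - x))))" for b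
    proof -
      have "cis (2 * pi * (b \<bullet> t)) * cis (2 * pi * (x \<bullet> b + \<xi> \<bullet> t)) = cis (2 * pi * (\<xi> \<bullet> t)) * cis (- (2 * pi * (b \<bullet> (- t - x))))"
        unfolding cis_mult by (rule arg_cong[where f=cis]) (simp add: inner_diff_right inner_commute algebra_simps)
      then show ?thesis by (simp add: phase_space_signal_def cis_cnj mult_ac)
    qed
    then have "(LINT b|lborel. phase_space_signal G (\<lambda>t. f' (- t)) (b, t) * cis (2 * pi * ((x, \<xi>) \<bullet> (b, t))))
      = f' (- t) * cis (2 * pi * (\<xi> \<bullet> t)) * cnj (g' (- t - x))"
      unfolding g'_def by (simp only: integral_mult_right_zero Bochner_Integration.integral_cnj)
    then show "u (- t) = (LINT b|lborel. phase_space_signal G (\<lambda>t. f' (- t)) (b, t) * cis (2 * pi * ((x, \<xi>) \<bullet> (b, t))))"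
      by (simp add: u_def)
  qed
  also have "\<dots> = (LINT p|(lborel \<Otimes>\<^sub>M lborel). phase_space_signal G (\<lambda>t. f' (- t)) p * cis (2 * pi * ((x, \<xi>) \<bullet> p)))"
  proof -
    have "integrable (lborel \<Otimes>\<^sub>M lborel) (\<lambda>p. phase_space_signal G (\<lambda>t. f' (- t)) p * cis (2 * pi * ((x, \<xi>) \<bullet> p)))"
      unfolding lborel_prod
      by (intro integrable_times_cis integrable_phase_space_signal integrable_reflect f' G) measurable
    then have "integrable (lborel \<Otimes>\<^sub>M lborel) (\<lambda>(b, t). phase_space_signal G (\<lambda>t. f' (- t)) (b, t) * cis (2 * pi * ((x, \<xi>) \<bullet> (b, t))))"
      by (simp only: case_prod_unfold prod.collapse)
    from lborel_pair.integral_snd[OF this] show ?thesis by (simp only: case_prod_unfold prod.collapse)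
  qed
  finally show ?thesis by (simp add: lborel_prod)
qed

lemma integrable_mult_translate_L2:
  fixes a :: "'a::euclidean_space \<Rightarrow> complex"
  assumes [measurable]: "a \<in> borel_measurable borel" and sq: "integrable lborel (\<lambda>t. (norm (a t))\<^sup>2)"
  shows "integrable lborel (\<lambda>t. a (t + y) * cnj (a t))"
proof (rule integrable_mult_L2)
  have "integrable lborel (\<lambda>t. of_real ((norm (a t))\<^sup>2) :: complex)" using sq by (simp only: complex_of_real_integrable_eq)
  from integrable_translate[OF this, of "- y"] show "integrable lborel (\<lambda>t. (norm (a (t + y)))\<^sup>2)"
    by (simp only: complex_of_real_integrable_eq diff_minus_eq_add)
qed (use sq in auto)

text \<open>
  The phase \<open>(b + \<beta>) \<bullet> (t + y) - b \<bullet> t\<close> splits as \<open>\<beta> \<bullet> y + b \<bullet> y + \<beta> \<bullet> t\<close>, so the integral over phase space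
  is a product of an integral over time and an integral over frequency.
\<close>

lemma autocorrelation_phase_space_signal:
  fixes a G :: "'a::euclidean_space \<Rightarrow> complex"
  assumes [measurable]: "a \<in> borel_measurable borel" "G \<in> borel_measurable borel"
    and a: "integrable lborel (\<lambda>t. (norm (a t))\<^sup>2)" and G: "integrable lborel (\<lambda>t. (norm (G t))\<^sup>2)"
  shows "autocorrelation (phase_space_signal G a) (\<beta>, y) = cis (2 * pi * (\<beta> \<bullet> y)) *
     (LINT t|lborel. a (t + y) * cnj (a t) * cis (2 * pi * (\<beta> \<bullet> t))) *
     (LINT b|lborel. cnj (G (b + \<beta>) * cnj (G b)) * cis (2 * pi * (y \<bullet> b)))"
proof -
  define u where "u t = a (t + y) * cnj (a t) * cis (2 * pi * (\<beta> \<bullet> t))" for t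
  define v where "v b = cnj (G (b + \<beta>) * cnj (G b)) * cis (2 * pi * (y \<bullet> b))" for b
  have u: "integrable lborel u" unfolding u_def
    by (rule integrable_times_cis[OF integrable_mult_translate_L2[OF _ a]]) measurable
  have v: "integrable lborel v" unfolding v_def
    by (rule integrable_times_cis[OF integrable_cnj[OF integrable_mult_translate_L2[OF _ G]]]) measurable
  have eq: "phase_space_signal G a (q + (\<beta>, y)) * cnj (phase_space_signal G a q) = cis (2 * pi * (\<beta> \<bullet> y)) * (case q of (b, t) \<Rightarrow> v b * u t)" for q
  proof (cases q)
    case (Pair b t)
    have "cis (2 * pi * ((b + \<beta>) \<bullet> (t + y))) * cis (- (2 * pi * (b \<bullet> t))) = cis (2 * pi * (\<beta> \<bullet> y)) * (cis (2 * pi * (y \<bullet> b)) * cis (2 * pi * (\<beta> \<bullet> t)))"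
      unfolding cis_mult by (rule arg_cong[where f=cis]) (simp add: inner_add_left inner_add_right inner_commute algebra_simps)
    then show ?thesis by (simp add: Pair phase_space_signal_def u_def v_def cis_cnj mult_ac)
  qed
  have "autocorrelation (phase_space_signal G a) (\<beta>, y) = cis (2 * pi * (\<beta> \<bullet> y)) * (LINT q|(lborel \<Otimes>\<^sub>M lborel). (case q of (b, t) \<Rightarrow> v b * u t))"
    unfolding autocorrelation_def eq lborel_prod by (rule integral_mult_right_zero)
  also have "(LINT q|(lborel \<Otimes>\<^sub>M lborel). (case q of (b, t) \<Rightarrow> v b * u t)) = (LINT b|lborel. (LINT t|lborel. v b * u t))"
    using lborel_pair.integral_fst'[OF integrable_tensor[OF v u]] by simp
  also have "\<dots> = integral\<^sup>L lborel u * integral\<^sup>L lborel v" by simp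
  finally show ?thesis unfolding u_def[abs_def] v_def[abs_def] by (simp only: mult.assoc)
qed

text \<open>
  If \<open>G\<close> were not zero almost everywhere, then by Fubini some \<open>b\<close> with \<open>G b \<noteq> 0\<close> would satisfy
  \<open>G (b + \<beta>) = 0\<close> for almost all \<open>\<beta>\<close>, a contradiction.
\<close>

lemma eq_0_if_translates_disjoint:
  fixes G :: "'a::euclidean_space \<Rightarrow> complex"
  assumes [measurable]: "G \<in> borel_measurable borel"
    and ae: "AE \<beta> in lborel. AE b in lborel. G (b + \<beta>) * cnj (G b) = 0"
  shows "AE b in lborel. G b = 0"
proof (rule ccontr)
  assume nz: "\<not> (AE b in lborel. G b = 0)"
  have "AE b in lborel. AE \<beta> in lborel. G (b + \<beta>) * cnj (G b) = 0"
    using ae by (subst lborel_pair.AE_commute) measurable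
  then obtain b where b: "G b \<noteq> 0" "AE \<beta> in lborel. G (b + \<beta>) * cnj (G b) = 0"
    by (rule ex_neq_0_if_AE[OF nz])
  then have "AE \<beta> in lborel. G (b + \<beta>) = 0" by simp
  then have "AE \<beta> in lborel. G \<beta> = 0" by (rule AE_translate) measurable
  with nz show False ..
qed

text \<open>
  The set where \<open>E\<close> is nonzero consists of the frequency shifts \<open>\<beta>\<close> for which the window factor \<open>Q \<beta>\<close> is not
  identically zero.  It has positive measure since \<open>G\<close> is not zero, and there the window factor can be
  cancelled for almost all \<open>y\<close>.
\<close>

lemma products_eq_if_autocorrelation_eq:
  fixes a c G :: "real ^ 'd::finite \<Rightarrow> complex"
  assumes am[measurable]: "a \<in> borel_measurable borel" and cm[measurable]: "c \<in> borel_measurable borel"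
    and Gm[measurable]: "G \<in> borel_measurable borel"
    and a: "integrable lborel (\<lambda>t. (norm (a t))\<^sup>2)" and c: "integrable lborel (\<lambda>t. (norm (c t))\<^sup>2)"
    and G: "integrable lborel (\<lambda>t. (norm (G t))\<^sup>2)"
    and supp: "\<And>t. norm t > r \<Longrightarrow> a t = 0" "\<And>t. norm t > r \<Longrightarrow> c t = 0" "\<And>b. norm b > r \<Longrightarrow> G b = 0"
    and nz: "\<not> (AE b in lborel. G b = 0)"
    and eq: "AE w in lborel. autocorrelation (phase_space_signal G a) w = autocorrelation (phase_space_signal G c) w"
  shows "AE y in lborel. AE t in lborel. a (t + y) * cnj (a t) = c (t + y) * cnj (c t)"
proof -
  define P where "P a \<beta> y = (LINT t|lborel. a (t + y) * cnj (a t) * cis (2 * pi * (\<beta> \<bullet> t)))" for a :: "real ^ 'd \<Rightarrow> complex" and \<beta> y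
  define Q where "Q \<beta> y = (LINT b|lborel. cnj (G (b + \<beta>) * cnj (G b)) * cis (2 * pi * (y \<bullet> b)))" for \<beta> y
  define E where "E \<beta> = (LINT b|lborel. norm (G (b + \<beta>) * cnj (G b)))" for \<beta>
  have [measurable]: "E \<in> borel_measurable borel" unfolding E_def by measurable
  have Pm: "(\<lambda>x. P a (snd x) (fst x)) \<in> borel_measurable (lborel \<Otimes>\<^sub>M lborel)" if [measurable]: "a \<in> borel_measurable borel" for a
    unfolding P_def by measurable
  note [measurable] = Pm[OF am] Pm[OF cm]
  have GG: "integrable lborel (\<lambda>b. G (b + \<beta>) * cnj (G b))" for \<beta>
    by (rule integrable_mult_translate_L2[OF Gm G])
  have E0: "E \<beta> = 0 \<longleftrightarrow> (AE b in lborel. G (b + \<beta>) * cnj (G b) = 0)" for \<beta>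
    unfolding E_def using GG by (subst integral_nonneg_eq_0_iff_AE) auto
  have "AE w in lborel \<Otimes>\<^sub>M lborel. autocorrelation (phase_space_signal G a) w = autocorrelation (phase_space_signal G c) w"
    unfolding lborel_prod by (rule eq)
  from lborel_pair.AE_pair[OF this]
  have "AE \<beta> in lborel. AE y in lborel. autocorrelation (phase_space_signal G a) (\<beta>, y) = autocorrelation (phase_space_signal G c) (\<beta>, y)" .
  then have "AE \<beta> in lborel. AE y in lborel. P a \<beta> y * Q \<beta> y = P c \<beta> y * Q \<beta> y"
    by (simp add: autocorrelation_phase_space_signal[OF am Gm a G] autocorrelation_phase_space_signal[OF cm Gm c G] P_def Q_def mult.assoc)
  then have "AE \<beta> in lborel. AE y in lborel. E \<beta> \<noteq> 0 \<longrightarrow> P a \<beta> y = P c \<beta> y"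
  proof eventually_elim
    case (elim \<beta>)
    show ?case
    proof (cases "E \<beta> = 0")
      case False
      have "AE y in lborel. Q \<beta> y \<noteq> 0" unfolding Q_def
      proof (rule AE_fourier_integral_neq_0)
        show "integrable lborel (\<lambda>b. cnj (G (b + \<beta>) * cnj (G b)))" by (rule integrable_cnj[OF GG])
        show "norm b \<le> r" if "cnj (G (b + \<beta>) * cnj (G b)) \<noteq> 0" for b
          using that supp(3)[of b] by (cases "norm b > r") auto
        show "\<not> (AE b in lborel. cnj (G (b + \<beta>) * cnj (G b)) = 0)" using False E0[of \<beta>] by simp
      qed
      with elim show ?thesis by eventually_elim simp
    qed simp
  qed
  then have "AE y in lborel. AE \<beta> in lborel. E \<beta> \<noteq> 0 \<longrightarrow> P a \<beta> y = P c \<beta> y"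
    by (subst lborel_pair.AE_commute) measurable
  then show ?thesis
  proof eventually_elim
    case (elim y)
    define \<phi> where "\<phi> t = a (t + y) * cnj (a t) - c (t + y) * cnj (c t)" for t
    have ia: "integrable lborel (\<lambda>t. a (t + y) * cnj (a t))" by (rule integrable_mult_translate_L2[OF am a])
    have ic: "integrable lborel (\<lambda>t. c (t + y) * cnj (c t))" by (rule integrable_mult_translate_L2[OF cm c])
    have "AE t in lborel. \<phi> t = 0"
    proof (rule ccontr)
      assume n\<phi>: "\<not> (AE t in lborel. \<phi> t = 0)"
      have "AE \<beta> in lborel. (LINT t|lborel. \<phi> t * cis (2 * pi * (\<beta> \<bullet> t))) \<noteq> 0"
      proof (rule AE_fourier_integral_neq_0[OF _ _ n\<phi>])
        show "integrable lborel \<phi>" unfolding \<phi>_def using ia ic by simp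
        show "norm t \<le> r" if "\<phi> t \<noteq> 0" for t
          using that supp(1)[of t] supp(2)[of t] by (cases "norm t > r") (auto simp: \<phi>_def)
      qed
      moreover have "(LINT t|lborel. \<phi> t * cis (2 * pi * (\<beta> \<bullet> t))) = P a \<beta> y - P c \<beta> y" for \<beta>
        unfolding \<phi>_def P_def left_diff_distrib
        by (rule Bochner_Integration.integral_diff) (intro integrable_times_cis ia ic; measurable)+
      ultimately have "AE \<beta> in lborel. P a \<beta> y \<noteq> P c \<beta> y" by simp
      with elim have "AE \<beta> in lborel. AE b in lborel. G (b + \<beta>) * cnj (G b) = 0"
        unfolding E0[symmetric] by eventually_elim blast
      from eq_0_if_translates_disjoint[OF Gm this] nz show False by blast
    qed
    then show ?case by (simp add: \<phi>_def)
  qed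
qed

section \<open>The uniqueness theorem\<close>

lemma paley_wiener_spectrum:
  fixes g :: "real ^ 'd::finite \<Rightarrow> complex"
  assumes K': "compact K'" and g: "g \<in> paley_wiener K'" and nz: "\<not> (AE t in lebesgue. g t = 0)"
  obtains G where "G \<in> borel_measurable borel" "integrable lborel G" "\<And>\<omega>. \<omega> \<notin> K' \<Longrightarrow> G \<omega> = 0"
    "integrable lborel (\<lambda>\<omega>. (norm (G \<omega>))\<^sup>2)" "\<not> (AE \<omega> in lborel. G \<omega> = 0)"
    "AE t in lborel. g t = (LINT \<omega>|lborel. G \<omega> * cis (2 * pi * (\<omega> \<bullet> t)))"
proof -
  obtain G0 where "fourier_L2 g G0" "ess_support G0 \<subseteq> K'" using g unfolding paley_wiener_def by blast
  from fourier_inversion_compact[OF this K'] obtain G where G: "G \<in> borel_measurable borel"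
    and Gi: "integrable lborel G" and G0: "\<And>\<omega>. \<omega> \<notin> K' \<Longrightarrow> G \<omega> = 0"
    and Gsq: "integrable lborel (\<lambda>\<omega>. (norm (G \<omega>))\<^sup>2)"
    and gG: "AE t in lborel. g t = (LINT \<omega>|lborel. G \<omega> * cis (2 * pi * (\<omega> \<bullet> t)))" by blast
  have Gnz: "\<not> (AE b in lborel. G b = 0)"
  proof
    assume "AE b in lborel. G b = 0"
    then have "(LINT \<omega>|lborel. G \<omega> * cis (2 * pi * (\<omega> \<bullet> t))) = 0" for t
      by (intro integral_eq_zero_AE) (auto elim!: eventually_mono)
    with gG nz show False by (simp add: AE_completion_iff)
  qed
  show ?thesis by (rule that[OF G Gi G0 Gsq Gnz gG])
qed

text \<open>
  The signals enter through their reflections \<open>a\<close> and \<open>c\<close>, so the integrands over phase space live on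
  \<open>K' \<times> uminus ` K\<close>.  The differences of points of this set form the set of the sampling hypothesis, because
  \<open>K - K\<close> is symmetric.
\<close>

lemma phase_uniqueness_if_sampling_lattice:
  fixes K K' :: "(real ^ 'd::finite) set" and g :: "real ^ 'd \<Rightarrow> complex"
  assumes K: "compact K" and K': "compact K'"
    and g: "g \<in> paley_wiener K'" and nz: "\<not> (AE t in lebesgue. g t = 0)"
    and U: "sampling_lattice K K' U"
  shows "phase_uniqueness_set U (L2_on K) g"
proof -
  obtain G where G[measurable]: "G \<in> borel_measurable borel"
    and Gi: "integrable lborel G" and G0: "\<And>\<omega>. \<omega> \<notin> K' \<Longrightarrow> G \<omega> = 0"
    and Gsq: "integrable lborel (\<lambda>\<omega>. (norm (G \<omega>))\<^sup>2)" and Gnz: "\<not> (AE b in lborel. G b = 0)"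
    and gG: "AE t in lborel. g t = (LINT \<omega>|lborel. G \<omega> * cis (2 * pi * (\<omega> \<bullet> t)))"
    using paley_wiener_spectrum[OF K' g nz] by blast
  obtain L D where UL: "lattice_with_dual U L" and D: "fundamental_domain L D"
    and TD: "difference_set K' K' \<times> difference_set K K \<subseteq> D"
    using U unfolding sampling_lattice_def by blast
  have cd: "compact (difference_set A A)" if "compact A" for A :: "(real ^ 'd) set"
    using compact_differences[OF that that] by (simp add: difference_set_def)
  have Tm: "difference_set K' K' \<times> difference_set K K \<in> sets borel"
    by (intro borel_compact compact_Times cd K K')
  obtain r where r: "\<And>x. x \<in> K \<union> K' \<Longrightarrow> norm x \<le> r"
    using compact_imp_bounded[OF compact_Un[OF K K']] unfolding bounded_iff by blast
  show ?thesis unfolding phase_uniqueness_set_def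
  proof (intro ballI impI)
    fix f h assume "f \<in> L2_on K" "h \<in> L2_on K" and VV: "\<forall>(x, \<xi>)\<in>U. norm (stft g f x \<xi>) = norm (stft g h x \<xi>)"
    then have f: "square_integrable f" "ess_support f \<subseteq> K" and h: "square_integrable h" "ess_support h \<subseteq> K"
      by (auto simp: L2_on_def)
    obtain f' where f'[measurable]: "f' \<in> borel_measurable borel" and ff': "AE x in lborel. f x = f' x"
      and f'sq: "integrable lborel (\<lambda>x. (norm (f' x))\<^sup>2)" and f'i: "integrable lborel f'" and f'0: "\<And>x. x \<notin> K \<Longrightarrow> f' x = 0"
      using L2_on_ex_borel[OF f K] by blast
    obtain h' where h'[measurable]: "h' \<in> borel_measurable borel" and hh': "AE x in lborel. h x = h' x"
      and h'sq: "integrable lborel (\<lambda>x. (norm (h' x))\<^sup>2)" and h'i: "integrable lborel h'" and h'0: "\<And>x. x \<notin> K \<Longrightarrow> h' x = 0"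
      using L2_on_ex_borel[OF h K] by blast
    define a where "a t = f' (- t)" for t
    define c where "c t = h' (- t)" for t
    have am: "a \<in> borel_measurable borel" and cm: "c \<in> borel_measurable borel" unfolding a_def c_def by measurable
    have ai: "integrable lborel a" and ci: "integrable lborel c"
      unfolding a_def c_def using integrable_reflect[OF f'i] integrable_reflect[OF h'i] by auto
    have asq: "integrable lborel (\<lambda>t. (norm (a t))\<^sup>2)" and csq: "integrable lborel (\<lambda>t. (norm (c t))\<^sup>2)"
      unfolding a_def c_def using integrable_reflect[OF f'sq] integrable_reflect[OF h'sq] by auto
    have ac: "AE w in lborel. autocorrelation (phase_space_signal G a) w = autocorrelation (phase_space_signal G c) w"
    proof (rule autocorrelation_determined_by_lattice[OF integrable_phase_space_signal[OF ai Gi] integrable_phase_space_signal[OF ci Gi] _ _ Tm TD _ D UL])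
      show "phase_space_signal G a p = 0" if "p \<notin> K' \<times> uminus ` K" for p
        using that f'0[of "- snd p"] G0[of "fst p"] by (cases p) (force simp: phase_space_signal_def a_def)
      show "phase_space_signal G c p = 0" if "p \<notin> K' \<times> uminus ` K" for p
        using that h'0[of "- snd p"] G0[of "fst p"] by (cases p) (force simp: phase_space_signal_def c_def)
      show "p - q \<in> difference_set K' K' \<times> difference_set K K" if pq: "p \<in> K' \<times> uminus ` K" "q \<in> K' \<times> uminus ` K" for p q
      proof -
        obtain b t b' t' where "p = (b, - t)" "q = (b', - t')" "b \<in> K'" "b' \<in> K'" "t \<in> K" "t' \<in> K"
          using pq by auto
        moreover have "- t - - t' = t' - t" by simp
        ultimately show ?thesis unfolding difference_set_def by fastforce
      qed
      show "norm (LINT p|lborel. phase_space_signal G a p * cis (2 * pi * (z \<bullet> p))) = norm (LINT p|lborel. phase_space_signal G c p * cis (2 * pi * (z \<bullet> p)))" if "z \<in> U" for z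
      proof (cases z)
        case (Pair x \<xi>)
        then have "norm (stft g f x \<xi>) = norm (stft g h x \<xi>)" using VV that by blast
        then show ?thesis
          unfolding Pair a_def c_def stft_eq_fourier_phase_space_signal[OF f'i ff' Gi gG]
            stft_eq_fourier_phase_space_signal[OF h'i hh' Gi gG] .
      qed
    qed
    have "AE y in lborel. AE t in lborel. a (t + y) * cnj (a t) = c (t + y) * cnj (c t)"
    proof (rule products_eq_if_autocorrelation_eq[OF am cm G asq csq Gsq _ _ _ Gnz ac, where r = r])
      show "a t = 0" "c t = 0" if "r < norm t" for t
        using that r[of "- t"] f'0[of "- t"] h'0[of "- t"] by (auto simp: a_def c_def)
      show "G b = 0" if "r < norm b" for b
        using that r[of b] G0[of b] by auto
    qed
    from eq_up_to_phase[OF am cm this] obtain \<tau> where \<tau>: "norm \<tau> = 1" "AE t in lborel. a t = \<tau> * c t" by blast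
    have "AE t in distr lborel borel uminus. a t = \<tau> * c t" using \<tau>(2) unfolding lborel_uminus .
    then have "AE t in lborel. f' t = \<tau> * h' t" using am cm by (subst (asm) AE_distr_iff) (auto simp: a_def c_def)
    then have "AE t in lborel. f t = \<tau> * h t" using ff' hh' by eventually_elim simp
    with \<tau>(1) show "\<exists>\<tau>. norm \<tau> = 1 \<and> (AE t in lebesgue. f t = \<tau> * h t)" by (auto simp: AE_completion_iff)
  qed
qed

lemma diameter_pos_if_paley_wiener:
  fixes K' :: "(real ^ 'd::finite) set" and g :: "real ^ 'd \<Rightarrow> complex"
  assumes K': "compact K'" and g: "g \<in> paley_wiener K'" and nz: "\<not> (AE t in lebesgue. g t = 0)"
  shows "0 < diameter K'"
proof (rule ccontr)
  assume "\<not> 0 < diameter K'"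
  have one: "x = y" if "x \<in> K'" "y \<in> K'" for x y
  proof -
    have "dist x y \<le> 0"
      using diameter_bounded_bound[OF compact_imp_bounded[OF K'] that] \<open>\<not> 0 < diameter K'\<close> by linarith
    then show ?thesis by simp
  qed
  obtain c where c: "K' \<subseteq> {c}" using one by (cases "K' = {}") auto
  obtain G where "G \<in> borel_measurable borel" "integrable lborel G" and G0: "\<And>\<omega>. \<omega> \<notin> K' \<Longrightarrow> G \<omega> = 0"
    and "integrable lborel (\<lambda>\<omega>. (norm (G \<omega>))\<^sup>2)" and Gnz: "\<not> (AE \<omega> in lborel. G \<omega> = 0)"
    and "AE t in lborel. g t = (LINT \<omega>|lborel. G \<omega> * cis (2 * pi * (\<omega> \<bullet> t)))"
    using paley_wiener_spectrum[OF K' g nz] by blast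
  have "AE \<omega> in lborel. G \<omega> = 0"
    using AE_lborel_singleton[of c] by eventually_elim (use c G0 in auto)
  with Gnz show False by blast
qed

lemma diagonal_matrix_inv:
  fixes c :: "'m::finite \<Rightarrow> real"
  assumes c: "\<And>i. c i \<noteq> 0"
  defines "diag \<equiv> \<lambda>c. (\<chi> i j. if i = j then c i else 0) :: real ^ 'm ^ 'm"
  shows "invertible (diag c)" "transpose (matrix_inv (diag c)) = diag (\<lambda>i. 1 / c i)"
proof -
  have mult: "diag a ** diag b = diag (\<lambda>i. a i * b i)" for a b
  proof -
    have "(\<Sum>k\<in>UNIV. (if i = k then a i else 0) * (if k = j then b k else 0)) = (if i = j then a i * b i else 0)" for i j
    proof -
      have "(\<Sum>k\<in>UNIV. (if i = k then a i else 0) * (if k = j then b k else 0)) = (\<Sum>k\<in>UNIV. if k = i then (if i = j then a i * b i else 0) else 0)"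
        by (rule sum.cong) auto
      then show ?thesis by simp
    qed
    then show ?thesis by (simp add: diag_def matrix_matrix_mult_def vec_eq_iff)
  qed
  have one: "diag (\<lambda>i. 1) = mat 1" by (simp add: diag_def mat_def vec_eq_iff)
  have inv: "diag c ** diag (\<lambda>i. 1 / c i) = mat 1" "diag (\<lambda>i. 1 / c i) ** diag c = mat 1"
    using c by (simp_all add: mult one)
  then show "invertible (diag c)" unfolding invertible_def by blast
  have "diag c ** matrix_inv (diag c) = mat 1"
    using inv unfolding matrix_inv_def by (rule_tac someI2) auto
  then have "matrix_inv (diag c) = diag (\<lambda>i. 1 / c i)"
    by (metis inv(2) matrix_mul_assoc matrix_mul_lid matrix_mul_rid)
  then show "transpose (matrix_inv (diag c)) = diag (\<lambda>i. 1 / c i)"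
    by (auto simp: diag_def transpose_def vec_eq_iff)
qed

text \<open>
  In the coordinates given by \<open>join_vec\<close>, the dual lattice consists of the points with coordinates
  \<open>2 * r i * z $ i\<close>, \<open>z\<close> integral.  Rounding shows that the translates of the box \<open>D\<close> cover.  Two
  distinct translates meet at most in points one of whose coordinates is prescribed, hence in a hyperplane.
\<close>

lemma sampling_lattice_separable:
  fixes K K' :: "(real ^ 'd::finite) set"
  assumes K: "compact K" "0 < diameter K" and K': "compact K'" "0 < diameter K'"
  shows "sampling_lattice K K' (separable_lattice (1 / (2 * diameter K')) (1 / (2 * diameter K)))"
proof -
  define r :: "'d + 'd \<Rightarrow> real" where "r i = (case i of Inl _ \<Rightarrow> diameter K' | Inr _ \<Rightarrow> diameter K)" for i
  have r: "r i > 0" for i using K K' by (simp add: r_def split: sum.split)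
  have rn: "r i \<noteq> 0" for i using r[of i] by simp
  define diag where "diag = (\<lambda>c. (\<chi> i j. if i = j then c i else 0) :: real ^ ('d + 'd) ^ ('d + 'd))"
  have dv: "(diag c *v z) $ i = c i * z $ i" for c z i
    by (simp add: diag_def matrix_vector_mult_def if_distrib if_distribR sum.delta cong: if_cong)
  define L where "L = matrix_lattice (diag (\<lambda>i. 2 * r i))"
  define D :: "((real ^ 'd) \<times> (real ^ 'd)) set" where "D = {p. \<forall>i. \<bar>join_vec p $ i\<bar> \<le> r i}"
  have "separable_lattice (1 / (2 * diameter K')) (1 / (2 * diameter K)) = matrix_lattice (diag (\<lambda>i. 1 / (2 * r i)))" (is "?U = ?V")
  proof (intro set_eqI iffI)
    fix p assume "p \<in> ?U"
    then obtain m n where mn: "m \<in> int_points" "n \<in> int_points" "p = ((1 / (2 * diameter K')) *\<^sub>R m, (1 / (2 * diameter K)) *\<^sub>R n)"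
      by (auto simp: separable_lattice_def)
    then have "join_vec (m, n) \<in> int_points" by (auto simp: int_points_def join_vec_def split: sum.split)
    moreover have "p = split_vec (diag (\<lambda>i. 1 / (2 * r i)) *v join_vec (m, n))"
      using mn by (simp add: split_vec_def dv r_def join_vec_def vec_eq_iff)
    ultimately show "p \<in> ?V" by (auto simp: matrix_lattice_def)
  next
    fix p assume "p \<in> ?V"
    then obtain z where z: "z \<in> int_points" "p = split_vec (diag (\<lambda>i. 1 / (2 * r i)) *v z)" by (auto simp: matrix_lattice_def)
    then have "fst p = (1 / (2 * diameter K')) *\<^sub>R fst (split_vec z)" "snd p = (1 / (2 * diameter K)) *\<^sub>R snd (split_vec z)"
      by (simp_all add: split_vec_def dv r_def vec_eq_iff)
    moreover have "fst (split_vec z) \<in> int_points" "snd (split_vec z) \<in> int_points"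
      using z(1) by (auto simp: int_points_def split_vec_def)
    ultimately show "p \<in> ?U" unfolding separable_lattice_def by (cases p) auto
  qed
  moreover have "transpose (matrix_inv (diag (\<lambda>i. 1 / (2 * r i)))) = diag (\<lambda>i. 2 * r i)" "invertible (diag (\<lambda>i. 1 / (2 * r i)))"
  proof -
    have nz: "1 / (2 * r i) \<noteq> 0" for i using rn[of i] by simp
    have "1 / (1 / (2 * r i)) = 2 * r i" for i by simp
    with diagonal_matrix_inv[of "\<lambda>i. 1 / (2 * r i)", OF nz] show
      "transpose (matrix_inv (diag (\<lambda>i. 1 / (2 * r i)))) = diag (\<lambda>i. 2 * r i)" "invertible (diag (\<lambda>i. 1 / (2 * r i)))"
      unfolding diag_def by (simp_all only:)
  qed
  ultimately have UL: "lattice_with_dual (separable_lattice (1 / (2 * diameter K')) (1 / (2 * diameter K))) L"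
    unfolding lattice_with_dual_def L_def by (metis (no_types, lifting))
  have jL: "\<exists>z\<in>int_points. \<forall>i. join_vec l $ i = 2 * r i * z $ i" if l: "l \<in> L" for l
  proof -
    obtain z where "z \<in> int_points" "l = split_vec (diag (\<lambda>i. 2 * r i) *v z)" using l by (auto simp: L_def matrix_lattice_def)
    moreover have "join_vec (split_vec v) = v" for v :: "real ^ ('d + 'd)"
      by (simp add: join_vec_def split_vec_def vec_eq_iff split: sum.split)
    ultimately show ?thesis by (auto simp: dv)
  qed
  have jv: "join_vec p $ i = split_vec (axis i 1) \<bullet> p" for p i
    by (simp add: inner_split_vec inner_axis')
  have jd: "join_vec (p - q) $ i = join_vec p $ i - join_vec q $ i" for p q :: "(real ^ 'd) \<times> (real ^ 'd)" and i
    by (simp add: linear_diff[OF linear_join_vec])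
  have "fundamental_domain L D"
    unfolding fundamental_domain_def
  proof (intro conjI ballI impI)
    have "closed D" unfolding D_def jv by (intro closed_Collect_all closed_Collect_le continuous_intros)
    then show "D \<in> sets lebesgue" using borel_closed sets_completionI_sets by (metis sets_lborel)
    show "(\<Union>l\<in>L. (+) l ` D) = UNIV"
    proof (intro equalityI subsetI UNIV_I)
      fix p :: "(real ^ 'd) \<times> (real ^ 'd)"
      define z :: "real ^ ('d + 'd)" where "z = (\<chi> i. of_int (round (join_vec p $ i / (2 * r i))))"
      define l where "l = split_vec (diag (\<lambda>i. 2 * r i) *v z)"
      have "z \<in> int_points" by (simp add: z_def int_points_def)
      then have "l \<in> L" by (auto simp: l_def L_def matrix_lattice_def)
      moreover have "join_vec l $ i = 2 * r i * z $ i" for i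
        by (cases i) (simp_all add: l_def join_vec_def split_vec_def dv)
      then have "\<bar>join_vec (p - l) $ i\<bar> \<le> r i" for i
      proof -
        have "\<bar>z $ i - join_vec p $ i / (2 * r i)\<bar> \<le> 1 / 2"
          unfolding z_def using of_int_round_abs_le[of "join_vec p $ i / (2 * r i)"] by simp
        then have "2 * r i * \<bar>z $ i - join_vec p $ i / (2 * r i)\<bar> \<le> 2 * r i * (1 / 2)"
          using r[of i] by (intro mult_left_mono) auto
        moreover have "2 * r i * \<bar>z $ i - join_vec p $ i / (2 * r i)\<bar> = \<bar>2 * r i * (z $ i - join_vec p $ i / (2 * r i))\<bar>"
          using r[of i] by (simp add: abs_mult)
        moreover have "2 * r i * (z $ i - join_vec p $ i / (2 * r i)) = - (join_vec (p - l) $ i)"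
          using r[of i] \<open>\<And>i. join_vec l $ i = 2 * r i * z $ i\<close> by (simp add: jd field_simps)
        ultimately show ?thesis by simp
      qed
      then have "p - l \<in> D" by (simp add: D_def)
      ultimately show "p \<in> (\<Union>l\<in>L. (+) l ` D)" by (intro UN_I[of l] image_eqI[of _ _ "p - l"]) auto
    qed
    fix l l' assume l: "l \<in> L" "l' \<in> L" "l \<noteq> l'"
    obtain z z' where z: "z \<in> int_points" "\<And>i. join_vec l $ i = 2 * r i * z $ i"
      and z': "z' \<in> int_points" "\<And>i. join_vec l' $ i = 2 * r i * z' $ i" using jL l by meson
    have "join_vec l \<noteq> join_vec l'" using l(3) by (metis split_join)
    then obtain i where i: "join_vec l $ i \<noteq> join_vec l' $ i" by (auto simp: vec_eq_iff)
    then have zz: "z $ i \<noteq> z' $ i" using z z' by auto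
    have sub: "((+) l ` D) \<inter> ((+) l' ` D) \<subseteq> {p. split_vec (axis i 1) \<bullet> p = r i * (z $ i + z' $ i)}"
    proof
      fix p assume "p \<in> ((+) l ` D) \<inter> ((+) l' ` D)"
      then obtain x y where "p = l + x" "p = l' + y" "x \<in> D" "y \<in> D" by blast
      then have "p - l \<in> D" "p - l' \<in> D" by (metis add_diff_cancel_left')+
      then have b: "\<bar>join_vec p $ i - 2 * r i * z $ i\<bar> \<le> r i" "\<bar>join_vec p $ i - 2 * r i * z' $ i\<bar> \<le> r i"
        by (auto simp: D_def jd z z')
      have int: "z $ i - z' $ i \<in> \<int>" using z(1) z'(1) by (auto simp: int_points_def)
      define x where "x = join_vec p $ i / r i"
      have x: "join_vec p $ i = r i * x" using r[of i] by (simp add: x_def)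
      have "\<bar>r i * (x - 2 * z $ i)\<bar> \<le> r i * 1" "\<bar>r i * (x - 2 * z' $ i)\<bar> \<le> r i * 1"
        using b by (simp_all add: x algebra_simps)
      then have xb: "\<bar>x - 2 * z $ i\<bar> \<le> 1" "\<bar>x - 2 * z' $ i\<bar> \<le> 1"
        using r[of i] by (simp_all add: abs_mult)
      have "1 \<le> \<bar>z $ i - z' $ i\<bar>" using Ints_nonzero_abs_ge1[OF int] zz by simp
      then have "x = z $ i + z' $ i" using xb by linarith
      then show "p \<in> {p. split_vec (axis i 1) \<bullet> p = r i * (z $ i + z' $ i)}"
        by (simp add: jv[symmetric] x)
    qed
    have "split_vec (axis i 1) \<noteq> (0 :: (real ^ 'd) \<times> (real ^ 'd))"
    proof
      assume "split_vec (axis i 1) = (0 :: (real ^ 'd) \<times> (real ^ 'd))"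
      then have "join_vec l $ i = 0" "join_vec l' $ i = 0" by (simp_all add: jv)
      with i show False by simp
    qed
    then have "negligible {p :: (real ^ 'd) \<times> (real ^ 'd). split_vec (axis i 1) \<bullet> p = r i * (z $ i + z' $ i)}"
      by (intro negligible_hyperplane) simp
    then show "((+) l ` D) \<inter> ((+) l' ` D) \<in> null_sets lebesgue"
      using negligible_subset[OF _ sub] by (simp add: negligible_iff_null_sets)
  qed
  moreover have "difference_set K' K' \<times> difference_set K K \<subseteq> D"
  proof -
    have d: "\<bar>u $ j\<bar> \<le> diameter A" if A: "compact A" and u: "u \<in> difference_set A A" for A and u :: "real ^ 'd" and j
    proof -
      obtain x y where xy: "x \<in> A" "y \<in> A" "u = x - y" using u by (auto simp: difference_set_def)
      have "\<bar>u $ j\<bar> \<le> norm u" by (rule component_le_norm_cart)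
      also have "\<dots> \<le> diameter A"
        using diameter_bounded_bound[OF compact_imp_bounded[OF A] xy(1,2)] by (simp add: xy dist_norm)
      finally show ?thesis .
    qed
    show ?thesis using d[OF K'(1)] d[OF K(1)]
      by (auto simp: D_def join_vec_def r_def split: sum.split)
  qed
  ultimately show ?thesis unfolding sampling_lattice_def using UL by blast
qed

theorem proposition2p3:
  fixes K K' :: "(real ^ 'd::finite) set" and g :: "real ^ 'd \<Rightarrow> complex"
  assumes "compact K" and "compact K'"
    and "g \<in> paley_wiener K'" and "\<not> (AE t in lebesgue. g t = 0)"
  shows "(\<forall>U. sampling_lattice K K' U \<longrightarrow> phase_uniqueness_set U (L2_on K) g) \<and>
    (0 < diameter K \<longrightarrow>
       (let U = separable_lattice (1 / (2 * diameter K')) (1 / (2 * diameter K))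
        in sampling_lattice K K' U \<and> phase_uniqueness_set U (L2_on K) g))"
  using phase_uniqueness_if_sampling_lattice[OF assms] diameter_pos_if_paley_wiener[OF assms(2-4)]
    sampling_lattice_separable[OF assms(1) _ assms(2)] by (simp add: Let_def)

end
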